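(* Let $\mathcal{T}$ be a staged tree. The kernel of $\varphi$ is the saturation of $I_{\mathcal{T}}$ with respect to $\mathbf{p}$, that is, $$\ker\varphi=I_{\mathcal{T}}:(\mathbf{p})^\infty .$$
   Context: A tree $\mathcal{T}=(V,E)$ is a finite directed rooted tree with root $v_0$ and at least one edge, edges directed away from the root, in which every vertex has either no or at least two outgoing edges. $E(v)\subseteq E$ is the set of edges going out of $v$. A staged tree is such a tree together with an edge labelling $e\mapsto\theta(e)$ and an equivalence relation $\sim$ on the non-leaf vertices ($v\sim w$ is read "$v$ and $w$ are in the same stage"), such that the edges out of one vertex have pairwise distinct labels, the sets of labels on $E(v)$ and $E(w)$ coincide if $v\sim w$, and these sets are disjoint if $v\not\sim w$. $\mathbb{R}[\Theta]=\mathbb{R}[\theta(e)\mid e\in E]$ is the polynomial ring with one indeterminate for each distinct label. Let $\lambda_1,\ldots,\lambda_n$ be the root-to-leaf paths and $E(\lambda_i)$ the edge set of $\lambda_i$. Let $$\varphi:\mathbb{R}[p_1,\ldots,p_n]\to\mathbb{R}[\Theta]/\langle\theta-1\rangle,\quad p_i\mapsto\prod_{e\in E(\lambda_i)}\theta(e),$$ where $\langle\theta-1\rangle=\langle\sum_{e\in E(v)}\theta(e)-1\mid v\in V\text{ non-leaf}\rangle$. Convention: $\ker\varphi$ is considered as a homogeneous ideal, that is, $\ker\varphi$ here denotes the ideal of $\mathbb{R}[p_1,\ldots,p_n]$ generated by all homogeneous polynomials (standard grading) mapped to $0$ by $\varphi$. For $v\in V$ let $[v]\subseteq\{1,\ldots,n\}$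 be the set of indices $i$ such that $\lambda_i$ passes through $v$, and let $p_{[v]}=\sum_{i\in[v]}p_i$. The ideal of model invariants is $$I_{\mathcal{T}}=\bigl\langle p_{[v]}p_{[w']}-p_{[v']}p_{[w]}\;\big|\; v\sim w,\ (v,v')\in E(v),\ (w,w')\in E(w)\text{ with the same label}\bigr\rangle\subseteq\mathbb{R}[p_1,\ldots,p_n].$$ The polynomial $\mathbf{p}=\prod_v p_{[v]}$, the product over all non-leaf vertices $v$, is the product of all denominators in the expressions $\theta(v,v')=p_{[v']}/p_{[v]}$. For an ideal $I$ of a ring $R$ and $x\in R$, $I:(x)^\infty=\{f\in R\mid x^m f\in I\text{ for some }m\ge0\}$. *)

theory Defs
  imports
    "HOL-Library.Poly_Mapping"
    "HOL-Algebra.QuotRing"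
    "Graph_Theory.Digraph"
    "Graph_Theory.Arc_Walk"
begin

section \<open>Multivariate polynomial rings over the reals\<close>

text \<open>
  A monomial is a finitely supported exponent vector and a polynomial is a finitely
  supported family of coefficients; multiplication on this type is convolution.
\<close>

type_synonym 'x rpoly = "('x \<Rightarrow>\<^sub>0 nat) \<Rightarrow>\<^sub>0 real"

definition PConst :: "real \<Rightarrow> 'x rpoly" where
  "PConst c = Poly_Mapping.single 0 c"

definition PVar :: "'x \<Rightarrow> 'x rpoly" where
  "PVar x = Poly_Mapping.single (Poly_Mapping.single x 1) 1"

definition indets :: "'x rpoly \<Rightarrow> 'x set" where
  "indets f = (\<Union>m\<in>Poly_Mapping.keys f. Poly_Mapping.keys m)"

text \<open>The ring of polynomials whose indeterminates are indexed by exactly the set \<open>X\<close>.\<close>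

definition poly_ring :: "'x set \<Rightarrow> 'x rpoly ring" where
  "poly_ring X = \<lparr>carrier = {f. indets f \<subseteq> X}, mult = (*), one = 1, zero = 0, add = (+)\<rparr>"

definition homogeneous :: "'x rpoly \<Rightarrow> bool" where
  "homogeneous f \<longleftrightarrow>
     (\<exists>d. \<forall>m\<in>Poly_Mapping.keys f. (\<Sum>x\<in>Poly_Mapping.keys m. Poly_Mapping.lookup m x) = d)"

definition psubst :: "('x \<Rightarrow> 'y rpoly) \<Rightarrow> 'x rpoly \<Rightarrow> 'y rpoly" where
  "psubst g f = (\<Sum>m\<in>Poly_Mapping.keys f. PConst (Poly_Mapping.lookup f m) *
     (\<Prod>x\<in>Poly_Mapping.keys m. g x ^ Poly_Mapping.lookup m x))"

definition saturation :: "('a, 'b) ring_scheme \<Rightarrow> 'a set \<Rightarrow> 'a \<Rightarrow> 'a set" where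
  "saturation R I x = {f \<in> carrier R. \<exists>m::nat. x [^]\<^bsub>R\<^esub> m \<otimes>\<^bsub>R\<^esub> f \<in> I}"

section \<open>Staged trees\<close>

definition inner_verts :: "('v, 'e) pre_digraph \<Rightarrow> 'v set" where
  "inner_verts T = {v \<in> verts T. out_arcs T v \<noteq> {}}"

text \<open>
  A rooted tree with arcs directed away from the root is a digraph in which every vertex is
  reached from the root by exactly one walk. The uniqueness is required among all walks, not
  just among paths, so that cycles and arcs into the root are excluded.
\<close>

locale rooted_tree = digraph T for T :: "('v, 'e) pre_digraph" +
  fixes v0 :: 'v
  assumes root_in_verts: "v0 \<in> verts T"
    and unique_walk: "v \<in> verts T \<Longrightarrow> \<exists>!w. awalk v0 w v"

locale staged_tree = rooted_tree T v0 for T :: "('v, 'e) pre_digraph" and v0 :: 'v +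
  fixes \<theta> :: "'e \<Rightarrow> 'l"
    and stage :: "('v \<times> 'v) set"
  assumes arcs_nonempty: "arcs T \<noteq> {}"
    and out_degree_cases: "v \<in> verts T \<Longrightarrow> out_degree T v = 0 \<or> out_degree T v \<ge> 2"
    and equiv_stage: "equiv (inner_verts T) stage"
    and labels_distinct: "v \<in> verts T \<Longrightarrow> inj_on \<theta> (out_arcs T v)"
    and labels_same_stage: "(v, w) \<in> stage \<Longrightarrow> \<theta> ` out_arcs T v = \<theta> ` out_arcs T w"
    and labels_other_stage:
      "\<lbrakk>v \<in> inner_verts T; w \<in> inner_verts T; (v, w) \<notin> stage\<rbrakk>
        \<Longrightarrow> \<theta> ` out_arcs T v \<inter> \<theta> ` out_arcs T w = {}"

definition root_leaf_paths :: "('v, 'e) pre_digraph \<Rightarrow> 'v \<Rightarrow> 'e awalk set" where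
  "root_leaf_paths T v0 =
     {w. \<exists>u \<in> verts T. out_arcs T u = {} \<and> pre_digraph.apath T v0 w u}"

section \<open>The parametrisation and its kernel\<close>

text \<open>
  In the following, \<open>ps\<close> enumerates the root-to-leaf paths by the indices \<open>1, \<dots>, n\<close>.
\<close>

definition label_ring :: "('v, 'e) pre_digraph \<Rightarrow> ('e \<Rightarrow> 'l) \<Rightarrow> 'l rpoly ring" where
  "label_ring T \<theta> = poly_ring (\<theta> ` arcs T)"

definition sum_to_one_ideal :: "('v, 'e) pre_digraph \<Rightarrow> ('e \<Rightarrow> 'l) \<Rightarrow> 'l rpoly set" where
  "sum_to_one_ideal T \<theta> =
     Idl\<^bsub>label_ring T \<theta>\<^esub> {(\<Sum>e\<in>out_arcs T v. PVar (\<theta> e)) - 1 | v. v \<in> inner_verts T}"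

definition path_hom ::
  "('v, 'e) pre_digraph \<Rightarrow> ('e \<Rightarrow> 'l) \<Rightarrow> (nat \<Rightarrow> 'e awalk) \<Rightarrow> nat rpoly \<Rightarrow> 'l rpoly set" where
  "path_hom T \<theta> ps f =
     sum_to_one_ideal T \<theta> +>\<^bsub>label_ring T \<theta>\<^esub> psubst (\<lambda>i. \<Prod>e\<in>set (ps i). PVar (\<theta> e)) f"

text \<open>
  The kernel of the parametrisation, considered as a homogeneous ideal: it is generated by
  the homogeneous polynomials that are mapped to zero.
\<close>

definition hom_kernel ::
  "('v, 'e) pre_digraph \<Rightarrow> ('e \<Rightarrow> 'l) \<Rightarrow> nat \<Rightarrow> (nat \<Rightarrow> 'e awalk) \<Rightarrow> nat rpoly set" where
  "hom_kernel T \<theta> n ps =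
     Idl\<^bsub>poly_ring {1..n}\<^esub>
       {f \<in> a_kernel (poly_ring {1..n}) (label_ring T \<theta> Quot sum_to_one_ideal T \<theta>)
              (path_hom T \<theta> ps). homogeneous f}"

section \<open>The ideal of model invariants\<close>

definition paths_through ::
  "('v, 'e) pre_digraph \<Rightarrow> 'v \<Rightarrow> nat \<Rightarrow> (nat \<Rightarrow> 'e awalk) \<Rightarrow> 'v \<Rightarrow> nat set" where
  "paths_through T v0 n ps v =
     {i \<in> {1..n}. v \<in> set (pre_digraph.awalk_verts T v0 (ps i))}"

definition p_sum ::
  "('v, 'e) pre_digraph \<Rightarrow> 'v \<Rightarrow> nat \<Rightarrow> (nat \<Rightarrow> 'e awalk) \<Rightarrow> 'v \<Rightarrow> nat rpoly" where
  "p_sum T v0 n ps v = (\<Sum>i\<in>paths_through T v0 n ps v. PVar i)"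

definition model_invariants ::
  "('v, 'e) pre_digraph \<Rightarrow> 'v \<Rightarrow> ('e \<Rightarrow> 'l) \<Rightarrow> ('v \<times> 'v) set \<Rightarrow> nat \<Rightarrow> (nat \<Rightarrow> 'e awalk)
     \<Rightarrow> nat rpoly set" where
  "model_invariants T v0 \<theta> stage n ps =
     Idl\<^bsub>poly_ring {1..n}\<^esub>
       {p_sum T v0 n ps v * p_sum T v0 n ps (head T f) -
        p_sum T v0 n ps (head T e) * p_sum T v0 n ps w | v w e f.
          (v, w) \<in> stage \<and> e \<in> out_arcs T v \<and> f \<in> out_arcs T w \<and> \<theta> e = \<theta> f}"

definition denominator_product ::
  "('v, 'e) pre_digraph \<Rightarrow> 'v \<Rightarrow> nat \<Rightarrow> (nat \<Rightarrow> 'e awalk) \<Rightarrow> nat rpoly" where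
  "denominator_product T v0 n ps = (\<Prod>v\<in>inner_verts T. p_sum T v0 n ps v)"

end

theory Submission
  imports Defs
begin

text \<open>
  Write \<open>p\<^sub>v\<close> for the sum \<open>p_sum T v0 n ps v\<close>, \<open>I\<close> for the ideal of model invariants, \<open>D\<close> for the
  product of the \<open>p\<^sub>v\<close> over the inner vertices, and \<open>J\<close> for the ideal of the relations which say that
  the labels out of a vertex sum to one.  A model invariant says that two edges with the same
  label have the same quotient \<open>p\<^sub>h / p\<^sub>t\<close> of head and tail.  So, after inverting \<open>D\<close>, the labels
  can be recovered from the \<open>p\<^sub>i\<close> modulo \<open>I\<close> as these quotients, and the parametrisation at these
  labels returns \<open>p\<^sub>i\<close> divided by the \<open>p\<close> of the root.

  The saturation lies in the kernel.  Adding up from the leaves, the relations in \<open>J\<close> give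
  \<open>\<phi> p\<^sub>v \<equiv>\<close> the product of the labels on the walk to \<open>v\<close> (\<open>\<phi>_p\<close>), hence \<open>\<phi>\<close> maps the invariants
  into \<open>J\<close> (\<open>\<phi>_I\<close>) and \<open>\<phi> D\<close> is congruent to a product of labels.  Each label is a nonzerodivisor
  modulo \<open>J\<close>: solving the relation of every stage for a label other than the given one identifies
  the quotient with a polynomial ring in which the given label is still an indeterminate
  (\<open>PVar_mult_mem_sum_to_one_IdlD\<close>).  So \<open>D\<^sup>k f \<in> I\<close> implies \<open>\<phi> f \<in> J\<close>.  As \<open>I\<close> and \<open>D\<close> are
  homogeneous, the same holds for every homogeneous component of \<open>f\<close>.

  The kernel lies in the saturation.  Clearing denominators, a label lifts to \<open>D\<close> times the
  quotient \<open>p\<^sub>h / p\<^sub>t\<close> of some edge with that label, and a polynomial in the labels lifts to the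
  substitution of these lifts, made homogeneous by powers of \<open>D\<close>.  In high
  enough degree this lift sends \<open>J\<close> into \<open>I\<close> (\<open>homogenized_lift_J\<close>), because the lifts of the labels
  out of a vertex sum to \<open>D\<close>.  The quotients telescope along a path, so lifting \<open>\<phi> p\<^sub>i\<close> and multiplying by \<open>p\<close>
  of the root gives a power of \<open>D\<close> times \<open>p\<^sub>i\<close> modulo \<open>I\<close> (\<open>meval_label_lift_walk_monomial\<close>).
  For a homogeneous \<open>f\<close> of degree \<open>d\<close> all monomials need the same power \<open>d\<close> of the root factor, and
  therefore \<open>\<phi> f \<in> J\<close> yields \<open>D\<^sup>N f \<in> I\<close>.
\<close>

section \<open>Polynomials, linear extension and substitution\<close>

definition polys :: "'x set \<Rightarrow> 'x rpoly set" where
  "polys X = carrier (poly_ring X)"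

lemma polys_iff: "f \<in> polys X \<longleftrightarrow> (\<forall>m\<in>Poly_Mapping.keys f. Poly_Mapping.keys m \<subseteq> X)"
  by (auto simp: polys_def poly_ring_def indets_def)

lemma polys_zero [simp, intro]: "0 \<in> polys X"
  and polys_one [simp, intro]: "1 \<in> polys X"
  by (auto simp: polys_iff)

lemma polys_single [intro]: "Poly_Mapping.keys m \<subseteq> X \<Longrightarrow> Poly_Mapping.single m c \<in> polys X"
  by (auto simp: polys_iff)

lemma polys_PVar [intro]: "x \<in> X \<Longrightarrow> PVar x \<in> polys X"
  by (auto simp: polys_iff PVar_def)

lemma polys_PConst [simp, intro]: "PConst c \<in> polys X"
  by (auto simp: polys_iff PConst_def)

lemma polys_add [intro]: "f \<in> polys X \<Longrightarrow> g \<in> polys X \<Longrightarrow> f + g \<in> polys X"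
  using keys_add[of f g] by (auto simp: polys_iff)

lemma keys_monomial_add: "Poly_Mapping.keys (m + n :: 'x \<Rightarrow>\<^sub>0 nat) = Poly_Mapping.keys m \<union> Poly_Mapping.keys n"
  by (auto simp: in_keys_iff lookup_add)

lemma polys_mult [intro]: "f \<in> polys X \<Longrightarrow> g \<in> polys X \<Longrightarrow> f * g \<in> polys X"
  using keys_mult[of f g] by (fastforce simp: polys_iff keys_monomial_add)

lemma polys_uminus [intro]: "f \<in> polys X \<Longrightarrow> - f \<in> polys X"
  by (auto simp: polys_iff in_keys_iff)

lemma polys_diff [intro]: "f \<in> polys X \<Longrightarrow> g \<in> polys X \<Longrightarrow> f - g \<in> polys X"
  using polys_add[of f X "-g"] by auto

lemma polys_power [intro]: "f \<in> polys X \<Longrightarrow> f ^ k \<in> polys X"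
  by (induction k) auto

lemma polys_sum [intro]: "(\<And>a. a \<in> A \<Longrightarrow> f a \<in> polys X) \<Longrightarrow> sum f A \<in> polys X"
  by (induction A rule: infinite_finite_induct) auto

lemma polys_prod [intro]: "(\<And>a. a \<in> A \<Longrightarrow> f a \<in> polys X) \<Longrightarrow> prod f A \<in> polys X"
  by (induction A rule: infinite_finite_induct) auto

lemma poly_eq_sum_monomials:
  "f = (\<Sum>m\<in>Poly_Mapping.keys f. Poly_Mapping.single m (Poly_Mapping.lookup f m))"
proof (rule poly_mapping_eqI)
  fix k
  show "Poly_Mapping.lookup f k
    = Poly_Mapping.lookup (\<Sum>m\<in>Poly_Mapping.keys f. Poly_Mapping.single m (Poly_Mapping.lookup f m)) k"
    by (simp add: lookup_sum lookup_single when_def in_keys_iff)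
qed

lemma polys_induct [consumes 1, case_names monomial add]:
  fixes f :: "'x rpoly"
  assumes f: "f \<in> polys X"
    and monomial: "\<And>m c. Poly_Mapping.keys m \<subseteq> X \<Longrightarrow> P (Poly_Mapping.single m c)"
    and add: "\<And>f g. P f \<Longrightarrow> P g \<Longrightarrow> P (f + g)"
  shows "P f"
proof -
  have zero: "P 0"
    using monomial[of 0 0] by simp
  have "P (\<Sum>m\<in>M. Poly_Mapping.single m (Poly_Mapping.lookup f m))"
    if "finite M" "\<And>m. m \<in> M \<Longrightarrow> Poly_Mapping.keys m \<subseteq> X" for M
    using that by (induction M) (auto intro: zero monomial add)
  from this[of "Poly_Mapping.keys f"] show ?thesis
    using f by (simp add: polys_iff flip: poly_eq_sum_monomials)
qed

lemma monomial_induct [consumes 1, case_names zero var]: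
  fixes m :: "'x \<Rightarrow>\<^sub>0 nat"
  assumes "Poly_Mapping.keys m \<subseteq> X"
    and zero: "P 0"
    and var: "\<And>x m. x \<in> X \<Longrightarrow> Poly_Mapping.keys m \<subseteq> X \<Longrightarrow> P m \<Longrightarrow> P (Poly_Mapping.single x 1 + m)"
  shows "P m"
  using assms(1)
proof (induction "\<Sum>x\<in>Poly_Mapping.keys m. Poly_Mapping.lookup m x" arbitrary: m rule: less_induct)
  case less
  show ?case
  proof (cases "m = 0")
    case False
    then obtain x where x: "x \<in> Poly_Mapping.keys m"
      by (metis all_not_in_conv keys_eq_empty)
    define m' where "m' = m - Poly_Mapping.single x 1"
    have m: "m = Poly_Mapping.single x 1 + m'"
      using x by (intro poly_mapping_eqI)
        (auto simp: m'_def lookup_add lookup_minus lookup_single when_def in_keys_iff)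
    then have keys: "Poly_Mapping.keys m = insert x (Poly_Mapping.keys m')"
      by (metis One_nat_def insert_is_Un keys_monomial_add keys_single nat.distinct(1))
    have "(\<Sum>y\<in>Poly_Mapping.keys m'. Poly_Mapping.lookup m' y)
        = (\<Sum>y\<in>Poly_Mapping.keys m. Poly_Mapping.lookup m' y)"
      by (rule sum.mono_neutral_left) (auto simp: keys in_keys_iff)
    also have "\<dots> < (\<Sum>y\<in>Poly_Mapping.keys m. Poly_Mapping.lookup m y)"
      by (rule sum_strict_mono_ex1) (use x in \<open>auto simp: m lookup_add intro!: bexI[of _ x]\<close>)
    finally have "P m'"
      using less keys by auto
    then show ?thesis
      using m x keys less.prems var[of x m'] by auto
  qed (use zero in simp)
qed

definition mdeg :: "('x \<Rightarrow>\<^sub>0 nat) \<Rightarrow> nat" where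
  "mdeg m = (\<Sum>x\<in>Poly_Mapping.keys m. Poly_Mapping.lookup m x)"

lemma mdeg_zero [simp]: "mdeg 0 = 0"
  and mdeg_single [simp]: "mdeg (Poly_Mapping.single x k) = k"
  by (auto simp: mdeg_def)

lemma mdeg_add [simp]: "mdeg (m + n) = mdeg m + mdeg n"
  unfolding mdeg_def by (rule setsum_keys_plus_distrib) auto

text \<open>
  The linear map that sends every monomial \<open>m\<close> to \<open>W m\<close>.  Substitution, projection to a homogeneous
  component and homogenized substitution are all of this form.
\<close>

definition lin :: "(('x \<Rightarrow>\<^sub>0 nat) \<Rightarrow> 'y rpoly) \<Rightarrow> 'x rpoly \<Rightarrow> 'y rpoly" where
  "lin W f = (\<Sum>m\<in>Poly_Mapping.keys f. PConst (Poly_Mapping.lookup f m) * W m)"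

lemma PConst_zero [simp]: "PConst 0 = 0"
  and PConst_one [simp]: "PConst 1 = 1"
  by (simp_all add: PConst_def)

lemma PConst_add: "PConst (a + b) = PConst a + PConst b"
  and PConst_mult: "PConst (a * b) = PConst a * PConst b"
  by (simp_all add: PConst_def single_add mult_single)

lemma lin_add: "lin W (f + g) = lin W f + lin W g"
  unfolding lin_def
  by (rule setsum_keys_plus_distrib) (auto simp: PConst_add distrib_right)

lemma lin_zero [simp]: "lin W 0 = 0"
  by (simp add: lin_def)

lemma lin_single: "lin W (Poly_Mapping.single m c) = PConst c * W m"
  by (simp add: lin_def)

lemma lin_uminus: "lin W (- f) = - lin W f"
proof -
  have "lin W f + lin W (- f) = 0"
    by (simp flip: lin_add)
  then show ?thesis
    by (simp add: add_eq_0_iff)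
qed

lemma lin_diff: "lin W (f - g) = lin W f - lin W g"
  using lin_add[of W f "- g"] by (simp add: lin_uminus)

lemma lin_sum: "lin W (sum f A) = (\<Sum>a\<in>A. lin W (f a))"
  by (induction A rule: infinite_finite_induct) (auto simp: lin_add)

lemma lin_PConst_mult: "lin W (PConst c * f) = PConst c * lin W f"
proof -
  have "f \<in> polys UNIV"
    by (simp add: polys_iff)
  then show ?thesis
    by (induction rule: polys_induct)
      (simp_all add: lin_add distrib_left lin_single PConst_def mult_single flip: mult.assoc)
qed

lemma lin_cong: "(\<And>m. m \<in> Poly_Mapping.keys f \<Longrightarrow> W m = W' m) \<Longrightarrow> lin W f = lin W' f"
  by (simp add: lin_def)

lemma lin_zero_fun: "lin (\<lambda>m. 0) f = 0"
  by (simp add: lin_def)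

lemma lin_monomials: "lin (\<lambda>m. Poly_Mapping.single m 1) f = f"
  using poly_eq_sum_monomials[of f] by (simp add: lin_def PConst_def mult_single)

lemma mult_lin: "q * lin W f = lin (\<lambda>m. q * W m) f"
  by (simp add: lin_def sum_distrib_left mult_ac)

lemma lin_diff_fun: "lin W f - lin W' f = lin (\<lambda>m. W m - W' m) f"
  by (simp add: lin_def sum_subtractf right_diff_distrib)

lemma lin_lin: "lin V (lin W f) = lin (\<lambda>m. lin V (W m)) f"
  by (subst (2) lin_def) (simp add: lin_sum lin_PConst_mult, simp add: lin_def)

lemma lin_in_polys: "(\<And>m. m \<in> Poly_Mapping.keys f \<Longrightarrow> W m \<in> polys X) \<Longrightarrow> lin W f \<in> polys X"
  by (auto simp: lin_def)

definition meval :: "('x \<Rightarrow> 'y rpoly) \<Rightarrow> ('x \<Rightarrow>\<^sub>0 nat) \<Rightarrow> 'y rpoly" where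
  "meval g m = (\<Prod>x\<in>Poly_Mapping.keys m. g x ^ Poly_Mapping.lookup m x)"

lemma meval_zero [simp]: "meval g 0 = 1"
  and meval_single [simp]: "meval g (Poly_Mapping.single x k) = g x ^ k"
  by (auto simp: meval_def)

lemma meval_superset:
  "finite A \<Longrightarrow> Poly_Mapping.keys m \<subseteq> A \<Longrightarrow> meval g m = (\<Prod>x\<in>A. g x ^ Poly_Mapping.lookup m x)"
  unfolding meval_def by (rule prod.mono_neutral_left) (auto simp: in_keys_iff)

lemma meval_add: "meval g (m + n) = meval g m * meval g n"
  using meval_superset[of "Poly_Mapping.keys m \<union> Poly_Mapping.keys n" m g]
    meval_superset[of "Poly_Mapping.keys m \<union> Poly_Mapping.keys n" n g]
    meval_superset[of "Poly_Mapping.keys m \<union> Poly_Mapping.keys n" "m + n" g]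
  by (simp add: keys_monomial_add lookup_add power_add prod.distrib)

lemma meval_in_polys:
  "Poly_Mapping.keys m \<subseteq> X \<Longrightarrow> (\<And>x. x \<in> X \<Longrightarrow> g x \<in> polys Y) \<Longrightarrow> meval g m \<in> polys Y"
  unfolding meval_def by auto

lemma psubst_eq_lin: "psubst g = lin (meval g)"
  by (auto simp: psubst_def lin_def meval_def)

lemma psubst_PVar [simp]: "psubst g (PVar x) = g x"
  by (simp add: psubst_eq_lin PVar_def lin_single)

lemma psubst_one [simp]: "psubst g 1 = 1"
  using lin_single[of "meval g" 0 1] by (simp add: psubst_eq_lin)

lemma psubst_mult: "psubst g (f * h) = psubst g f * psubst g h"
proof -
  have "f \<in> polys UNIV" and h: "h \<in> polys UNIV"
    by (simp_all add: polys_iff)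
  from this(1) show ?thesis
  proof (induction rule: polys_induct)
    case (monomial m c)
    show ?case
      using h
      by (induction rule: polys_induct)
        (simp_all add: psubst_eq_lin lin_add lin_single distrib_left distrib_right mult_single
          meval_add PConst_mult mult_ac)
  qed (simp add: psubst_eq_lin lin_add distrib_right)
qed

lemmas psubst_zero = lin_zero[of "meval g" for g, folded psubst_eq_lin]
lemmas psubst_add = lin_add[of "meval g" for g, folded psubst_eq_lin]
lemmas psubst_diff = lin_diff[of "meval g" for g, folded psubst_eq_lin]
lemmas psubst_sum = lin_sum[of "meval g" for g, folded psubst_eq_lin]

lemma psubst_in_polys:
  "f \<in> polys X \<Longrightarrow> (\<And>x. x \<in> X \<Longrightarrow> g x \<in> polys Y) \<Longrightarrow> psubst g f \<in> polys Y"
  unfolding psubst_eq_lin polys_iff[of f] by (auto intro!: lin_in_polys meval_in_polys)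

lemma PVar_mult_eq_0D:
  assumes "PVar x * f = 0"
  shows "f = 0"
proof (rule poly_mapping_eqI)
  fix k
  have "Poly_Mapping.lookup (PVar x * f) (Poly_Mapping.single x 1 + k) = Poly_Mapping.lookup f k"
    unfolding PVar_def lookup_mult
    by (subst Sum_any.expand_superset[of "{Poly_Mapping.single x 1}"])
      (auto simp: lookup_single when_def)
  then show "Poly_Mapping.lookup f k = Poly_Mapping.lookup 0 k"
    using assms by simp
qed

section \<open>Ideals of polynomial rings\<close>

lemma poly_ring_simps [simp]:
  "carrier (poly_ring X) = polys X" "mult (poly_ring X) = (*)" "one (poly_ring X) = 1"
  "zero (poly_ring X) = 0" "add (poly_ring X) = (+)"
  by (simp_all add: polys_def) (simp_all add: poly_ring_def)

lemma cring_poly_ring: "cring (poly_ring X)"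
proof (rule cringI)
  show "abelian_group (poly_ring X)"
    by (rule abelian_groupI) (auto simp: add_ac intro: bexI[of _ "- x" for x])
  show "comm_monoid (poly_ring X)"
    by (rule comm_monoidI) (auto simp: mult_ac)
qed (auto simp: distrib_right)

lemma nat_pow_poly_ring [simp]: "f [^]\<^bsub>poly_ring X\<^esub> (k::nat) = f ^ k"
  by (induction k) (simp_all add: mult.commute)

text \<open>
  Closure under negation is the case \<open>c = - 1\<close> of closure under multiplication.
\<close>

definition poly_ideal :: "'x set \<Rightarrow> 'x rpoly set \<Rightarrow> bool" where
  "poly_ideal X A \<longleftrightarrow> A \<subseteq> polys X \<and> 0 \<in> A \<and> (\<forall>a\<in>A. \<forall>b\<in>A. a + b \<in> A) \<and>
     (\<forall>a\<in>A. \<forall>c\<in>polys X. c * a \<in> A)"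

lemma ideal_poly_ring_iff: "ideal A (poly_ring X) \<longleftrightarrow> poly_ideal X A"
proof
  assume "ideal A (poly_ring X)"
  then interpret ideal A "poly_ring X" .
  show "poly_ideal X A"
    using a_subset additive_subgroup.zero_closed[OF is_additive_subgroup] I_l_closed
      additive_subgroup.a_closed[OF is_additive_subgroup]
    by (auto simp: poly_ideal_def)
next
  assume A: "poly_ideal X A"
  interpret cring "poly_ring X" by (rule cring_poly_ring)
  have neg: "- a \<in> A" if "a \<in> A" for a
  proof -
    have "PConst (- 1) * a \<in> A"
      using A that by (simp add: poly_ideal_def)
    then show ?thesis
      by (simp add: PConst_def single_uminus)
  qed
  have inv: "\<ominus>\<^bsub>poly_ring X\<^esub> a = - a" if "a \<in> polys X" for a
    using that by (intro minus_equality) auto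
  show "ideal A (poly_ring X)"
  proof (rule idealI)
    show "subgroup A (add_monoid (poly_ring X))"
      using A neg inv[unfolded a_inv_def, simplified]
      by (intro subgroup.intro) (auto simp: poly_ideal_def subset_iff)
  qed (use A in \<open>auto simp: poly_ideal_def mult.commute intro: ring_axioms\<close>)
qed

context
  fixes X :: "'x set" and A :: "'x rpoly set"
  assumes A: "poly_ideal X A"
begin

lemma ideal_sub: "a \<in> A \<Longrightarrow> a \<in> polys X"
  using A by (auto simp: poly_ideal_def)

lemma ideal_zero: "0 \<in> A"
  using A by (auto simp: poly_ideal_def)

lemma ideal_add: "a \<in> A \<Longrightarrow> b \<in> A \<Longrightarrow> a + b \<in> A"
  using A by (auto simp: poly_ideal_def)

lemma ideal_mult_left: "a \<in> A \<Longrightarrow> c \<in> polys X \<Longrightarrow> c * a \<in> A"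
  using A by (auto simp: poly_ideal_def)

lemma ideal_mult_right: "a \<in> A \<Longrightarrow> c \<in> polys X \<Longrightarrow> a * c \<in> A"
  using ideal_mult_left by (simp add: mult.commute)

lemma ideal_uminus: "a \<in> A \<Longrightarrow> - a \<in> A"
  using ideal_mult_left[of a "- 1"] by auto

lemma ideal_diff: "a \<in> A \<Longrightarrow> b \<in> A \<Longrightarrow> a - b \<in> A"
  using ideal_add[of a "- b"] ideal_uminus[of b] by simp

lemma ideal_sum: "(\<And>i. i \<in> S \<Longrightarrow> f i \<in> A) \<Longrightarrow> sum f S \<in> A"
  by (induction S rule: infinite_finite_induct) (auto intro: ideal_zero ideal_add)

lemma ideal_lin: "(\<And>m. m \<in> Poly_Mapping.keys f \<Longrightarrow> W m \<in> A) \<Longrightarrow> lin W f \<in> A"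
  unfolding lin_def by (intro ideal_sum ideal_mult_left) auto

lemma ideal_cong_mem: "a - b \<in> A \<Longrightarrow> a \<in> A \<longleftrightarrow> b \<in> A"
  using ideal_add[of "a - b" b] ideal_diff[of a "a - b"] by auto

lemma ideal_cong_sym: "a - b \<in> A \<Longrightarrow> b - a \<in> A"
  using ideal_uminus[of "a - b"] by simp

lemma ideal_cong_trans: "a - b \<in> A \<Longrightarrow> b - c \<in> A \<Longrightarrow> a - c \<in> A"
  using ideal_add[of "a - b" "b - c"] by simp

lemma ideal_cong_mult:
  assumes "a - b \<in> A" "c - d \<in> A" "b \<in> polys X" "c \<in> polys X"
  shows "a * c - b * d \<in> A"
proof -
  have "a * c - b * d = (a - b) * c + b * (c - d)"
    by (simp add: algebra_simps)
  then show ?thesis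
    using assms ideal_add[OF ideal_mult_right[of "a - b" c] ideal_mult_left[of "c - d" b]] by simp
qed

lemma ideal_cong_sum:
  assumes "\<And>i. i \<in> S \<Longrightarrow> f i - g i \<in> A"
  shows "sum f S - sum g S \<in> A"
  unfolding sum_subtractf[symmetric] using assms by (rule ideal_sum)

end

lemma Idl_poly_ideal: "G \<subseteq> polys X \<Longrightarrow> poly_ideal X (Idl\<^bsub>poly_ring X\<^esub> G)"
  using ring.genideal_ideal[OF cring.axioms(1)[OF cring_poly_ring], of G X]
  by (simp add: ideal_poly_ring_iff)

lemma Idl_generator: "G \<subseteq> polys X \<Longrightarrow> g \<in> G \<Longrightarrow> g \<in> Idl\<^bsub>poly_ring X\<^esub> G"
  using ring.genideal_self[OF cring.axioms(1)[OF cring_poly_ring], of G X] by auto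

lemma Idl_minimal: "poly_ideal X A \<Longrightarrow> G \<subseteq> A \<Longrightarrow> Idl\<^bsub>poly_ring X\<^esub> G \<subseteq> A"
  using ring.genideal_minimal[OF cring.axioms(1)[OF cring_poly_ring], of A X G]
  by (simp add: ideal_poly_ring_iff)

lemma coset_eq_ideal_iff:
  assumes "poly_ideal X A" "f \<in> polys X"
  shows "A +>\<^bsub>poly_ring X\<^esub> f = A \<longleftrightarrow> f \<in> A"
proof -
  have "ideal A (poly_ring X)"
    using assms(1) by (simp add: ideal_poly_ring_iff)
  then show ?thesis
    using ideal.rcos_const_imp_mem[of A "poly_ring X" f] assms(2)
      ring.a_rcos_zero[OF cring.axioms(1)[OF cring_poly_ring], of A X f] by auto
qed

lemma saturation_poly_ring:
  "saturation (poly_ring X) A q = {f \<in> polys X. \<exists>m. q ^ m * f \<in> A}"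
  by (simp add: saturation_def)

lemma poly_ideal_saturation:
  assumes A: "poly_ideal X A" and q: "q \<in> polys X"
  shows "poly_ideal X (saturation (poly_ring X) A q)"
  unfolding poly_ideal_def saturation_poly_ring
proof (intro conjI ballI)
  fix f g
  assume "f \<in> {f \<in> polys X. \<exists>m. q ^ m * f \<in> A}" "g \<in> {f \<in> polys X. \<exists>m. q ^ m * f \<in> A}"
  then obtain k l where f: "f \<in> polys X" "q ^ k * f \<in> A" and g: "g \<in> polys X" "q ^ l * g \<in> A"
    by auto
  have "q ^ (k + l) * (f + g) = q ^ l * (q ^ k * f) + q ^ k * (q ^ l * g)"
    by (simp add: power_add algebra_simps)
  also have "\<dots> \<in> A"
    using f g q by (auto intro!: ideal_add[OF A] ideal_mult_left[OF A])
  finally show "f + g \<in> {f \<in> polys X. \<exists>m. q ^ m * f \<in> A}"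
    using f g by blast
next
  fix f c
  assume "f \<in> {f \<in> polys X. \<exists>m. q ^ m * f \<in> A}" and c: "c \<in> polys X"
  then obtain k where f: "f \<in> polys X" "q ^ k * f \<in> A"
    by auto
  have "q ^ k * (c * f) = c * (q ^ k * f)"
    by (simp add: mult_ac)
  also have "\<dots> \<in> A"
    using f c by (auto intro!: ideal_mult_left[OF A])
  finally show "c * f \<in> {f \<in> polys X. \<exists>m. q ^ m * f \<in> A}"
    using f c by blast
qed (use ideal_zero[OF A] in auto)

section \<open>Homogeneous components\<close>

definition hcomp :: "nat \<Rightarrow> 'x rpoly \<Rightarrow> 'x rpoly" where
  "hcomp d = lin (\<lambda>m. if mdeg m = d then Poly_Mapping.single m 1 else 0)"

definition homog :: "nat \<Rightarrow> 'x rpoly \<Rightarrow> bool" where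
  "homog d f \<longleftrightarrow> (\<forall>m\<in>Poly_Mapping.keys f. mdeg m = d)"

lemma homogeneous_iff: "homogeneous f \<longleftrightarrow> (\<exists>d. homog d f)"
  by (simp add: homogeneous_def homog_def mdeg_def)

lemma homog_zero [simp]: "homog d 0"
  and homog_one: "homog 0 1"
  and homog_PVar: "homog 1 (PVar x)"
  by (auto simp: homog_def PVar_def)

lemma homog_add: "homog d f \<Longrightarrow> homog d g \<Longrightarrow> homog d (f + g)"
  using keys_add[of f g] by (auto simp: homog_def)

lemma homog_uminus: "homog d f \<Longrightarrow> homog d (- f)"
  by (auto simp: homog_def in_keys_iff)

lemma homog_diff: "homog d f \<Longrightarrow> homog d g \<Longrightarrow> homog d (f - g)"
  using homog_add[of d f "- g"] by (simp add: homog_uminus)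

lemma homog_sum: "(\<And>a. a \<in> A \<Longrightarrow> homog d (f a)) \<Longrightarrow> homog d (sum f A)"
  by (induction A rule: infinite_finite_induct) (auto intro: homog_add)

lemma homog_mult: "homog d f \<Longrightarrow> homog e g \<Longrightarrow> homog (d + e) (f * g)"
  using keys_mult[of f g] by (fastforce simp: homog_def)

lemma homog_power: "homog d f \<Longrightarrow> homog (k * d) (f ^ k)"
  by (induction k) (auto intro: homog_one homog_mult)

lemma homog_prod:
  "finite A \<Longrightarrow> (\<And>a. a \<in> A \<Longrightarrow> homog d (f a)) \<Longrightarrow> homog (card A * d) (prod f A)"
  by (induction A rule: finite_induct) (auto intro: homog_one homog_mult)

lemma homog_hcomp: "homog d (hcomp d f)"
  unfolding hcomp_def lin_def by (intro homog_sum) (auto simp: homog_def PConst_def mult_single)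

lemma hcomp_in_polys: "f \<in> polys X \<Longrightarrow> hcomp d f \<in> polys X"
  unfolding hcomp_def by (intro lin_in_polys) (auto simp: polys_iff)

lemma hcomp_homog: "homog d f \<Longrightarrow> hcomp e f = (if d = e then f else 0)"
  unfolding hcomp_def
  by (subst lin_cong[of _ _ "\<lambda>m. if d = e then Poly_Mapping.single m 1 else 0"])
    (auto simp: homog_def lin_monomials lin_zero_fun)

lemma hcomp_add: "hcomp d (f + g) = hcomp d f + hcomp d g"
  by (simp add: hcomp_def lin_add)

lemma sum_hcomp:
  assumes "\<And>m. m \<in> Poly_Mapping.keys f \<Longrightarrow> mdeg m \<le> N"
  shows "f = (\<Sum>d\<le>N. hcomp d f)"
proof -
  have "(\<Sum>d\<le>N. hcomp d f) = (\<Sum>m\<in>Poly_Mapping.keys f. \<Sum>d\<le>N.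
      PConst (Poly_Mapping.lookup f m) * (if mdeg m = d then Poly_Mapping.single m 1 else 0))"
    unfolding hcomp_def lin_def by (rule sum.swap)
  also have "\<dots> = lin (\<lambda>m. Poly_Mapping.single m 1) f"
    using assms by (auto simp: lin_def sum.delta if_distrib cong: if_cong intro!: sum.cong)
  finally show ?thesis
    by (simp add: lin_monomials)
qed

lemma hcomp_homog_mult:
  assumes "homog k q"
  shows "hcomp d (q * f) = (if k \<le> d then q * hcomp (d - k) f else 0)"
proof -
  have *: "hcomp d (q * Poly_Mapping.single m c)
      = (if k \<le> d then q * hcomp (d - k) (Poly_Mapping.single m c) else 0)" for m c
  proof -
    have "homog (mdeg m) (Poly_Mapping.single m c)"
      by (simp add: homog_def)
    then have "hcomp e (Poly_Mapping.single m c) = (if mdeg m = e then Poly_Mapping.single m c else 0)"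
      and "hcomp d (q * Poly_Mapping.single m c) = (if k + mdeg m = d then q * Poly_Mapping.single m c else 0)"
      for e
      using homog_mult[OF assms] by (auto simp: hcomp_homog)
    then show ?thesis
      by auto
  qed
  have "f \<in> polys UNIV"
    by (simp add: polys_iff)
  then show ?thesis
    by (induction rule: polys_induct)
      (simp_all add: * hcomp_add distrib_left)
qed

text \<open>
  The polynomials whose homogeneous components all lie in the generated ideal form an ideal:
  multiplication by a monomial only shifts the components.
\<close>

lemma hcomp_in_homogeneous_Idl:
  assumes G: "G \<subseteq> polys X" and hom: "\<And>g. g \<in> G \<Longrightarrow> homogeneous g"
    and f: "f \<in> Idl\<^bsub>poly_ring X\<^esub> G"
  shows "hcomp d f \<in> Idl\<^bsub>poly_ring X\<^esub> G"
proof -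
  let ?I = "Idl\<^bsub>poly_ring X\<^esub> G"
  have I: "poly_ideal X ?I"
    using G by (rule Idl_poly_ideal)
  let ?K = "{f \<in> polys X. \<forall>d. hcomp d f \<in> ?I}"
  have "poly_ideal X ?K"
    unfolding poly_ideal_def
  proof (intro conjI ballI)
    fix a c
    assume a: "a \<in> ?K" and "c \<in> polys X"
    from this(2) show "c * a \<in> ?K"
    proof (induction rule: polys_induct)
      case (monomial m c)
      have "homog (mdeg m) (Poly_Mapping.single m c)"
        by (simp add: homog_def)
      then show ?case
        using a monomial
        by (auto simp: hcomp_homog_mult intro!: ideal_mult_left[OF I] ideal_zero[OF I])
    qed (auto simp: hcomp_def lin_add distrib_right intro: ideal_add[OF I])
  qed (auto simp: hcomp_def lin_add intro: ideal_add[OF I] ideal_zero[OF I])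
  moreover have "G \<subseteq> ?K"
  proof
    fix g assume g: "g \<in> G"
    then obtain k where "homog k g"
      using hom homogeneous_iff by blast
    then show "g \<in> ?K"
      using g G Idl_generator[OF G g] by (auto simp: hcomp_homog ideal_zero[OF I])
  qed
  ultimately show ?thesis
    using Idl_minimal f by blast
qed

section \<open>Labels are nonzerodivisors modulo the sum-to-one relations\<close>

lemma psubst_cong_id:
  assumes A: "poly_ideal X A" and s: "\<And>x. x \<in> X \<Longrightarrow> s x - PVar x \<in> A" and f: "f \<in> polys X"
  shows "psubst s f - f \<in> A"
proof -
  have sX: "s x \<in> polys X" if "x \<in> X" for x
    using polys_add[OF ideal_sub[OF A s[OF that]] polys_PVar[OF that]] by simp
  have "meval s m - Poly_Mapping.single m 1 \<in> A" if "Poly_Mapping.keys m \<subseteq> X" for m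
    using that
  proof (induction rule: monomial_induct)
    case zero
    then show ?case by (simp add: ideal_zero[OF A])
  next
    case (var x m)
    have "s x * meval s m - PVar x * Poly_Mapping.single m 1 \<in> A"
      using var sX
      by (intro ideal_cong_mult[OF A s] meval_in_polys polys_PVar) auto
    then show ?case
      by (simp add: meval_add PVar_def mult_single)
  qed
  then have "lin (\<lambda>m. meval s m - Poly_Mapping.single m 1) f \<in> A"
    using f by (auto intro!: ideal_lin[OF A] simp: polys_iff)
  then show ?thesis
    by (simp add: psubst_eq_lin lin_monomials flip: lin_diff_fun)
qed

text \<open>
  In each class \<open>L\<close> choose a variable \<open>r L \<noteq> x\<close> and substitute for it one minus the sum of the other
  variables of \<open>L\<close>.  This substitution \<open>s\<close> is the identity modulo \<open>J\<close> and maps \<open>J\<close> to zero, so membership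
  in \<open>J\<close> means that \<open>s\<close> gives zero.  Since \<open>s\<close> fixes \<open>x\<close>, the claim reduces to cancelling the
  variable \<open>x\<close> in a polynomial ring.  The bound on the cardinalities makes the choice of \<open>r L\<close> possible.
\<close>

lemma PVar_mult_mem_sum_to_one_IdlD:
  assumes fin: "\<And>L. L \<in> \<L> \<Longrightarrow> finite L \<and> 2 \<le> card L"
    and disj: "\<And>L M. L \<in> \<L> \<Longrightarrow> M \<in> \<L> \<Longrightarrow> L \<noteq> M \<Longrightarrow> L \<inter> M = {}"
    and J: "J = Idl\<^bsub>poly_ring (\<Union>\<L>)\<^esub> {(\<Sum>l\<in>L. PVar l) - 1 | L. L \<in> \<L>}"
    and x: "x \<in> \<Union>\<L>" and f: "f \<in> polys (\<Union>\<L>)" and xf: "PVar x * f \<in> J"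
  shows "f \<in> J"
proof -
  let ?G = "{(\<Sum>l\<in>L. PVar l) - 1 | L. L \<in> \<L>} :: 'a rpoly set"
  have G: "?G \<subseteq> polys (\<Union>\<L>)"
    by auto
  then have J_ideal: "poly_ideal (\<Union>\<L>) J"
    unfolding J by (rule Idl_poly_ideal)
  have gen: "(\<Sum>l\<in>L. PVar l) - 1 \<in> J" if "L \<in> \<L>" for L
    unfolding J using that by (intro Idl_generator[OF G]) auto
  have "\<exists>l\<in>L. l \<noteq> x" if "L \<in> \<L>" for L
  proof (rule ccontr)
    assume "\<not> ?thesis"
    then have "card L \<le> card {x}"
      by (intro card_mono) auto
    then show False
      using fin[OF that] by simp
  qed
  then obtain r where r: "\<And>L. L \<in> \<L> \<Longrightarrow> r L \<in> L" "\<And>L. L \<in> \<L> \<Longrightarrow> r L \<noteq> x"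
    by metis
  have "\<exists>c. \<forall>l\<in>\<Union>\<L>. c l \<in> \<L> \<and> l \<in> c l"
    by (rule bchoice) auto
  then obtain c where c: "\<And>l. l \<in> \<Union>\<L> \<Longrightarrow> c l \<in> \<L>" "\<And>l. l \<in> \<Union>\<L> \<Longrightarrow> l \<in> c l"
    by blast
  have c_eq: "c l = L" if "L \<in> \<L>" "l \<in> L" for l L
    using disj[of "c l" L] c[of l] that by auto
  define s where "s l = (if l \<in> \<Union>\<L> \<and> l = r (c l)
    then 1 - (\<Sum>k\<in>c l - {l}. PVar k) else PVar l)" for l
  have s_J: "s l - PVar l \<in> J" if l: "l \<in> \<Union>\<L>" for l
  proof (cases "l = r (c l)")
    case True
    have "(\<Sum>k\<in>c l. PVar k) = PVar l + (\<Sum>k\<in>c l - {l}. PVar k :: 'a rpoly)"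
      using fin c[OF l] by (intro sum.remove) auto
    then have "s l - PVar l = - ((\<Sum>k\<in>c l. PVar k) - 1)"
      using True l by (simp add: s_def)
    then show ?thesis
      using ideal_uminus[OF J_ideal gen[OF c(1)[OF l]]] by simp
  next
    case False
    then show ?thesis
      by (simp add: s_def ideal_zero[OF J_ideal])
  qed
  have s_gen: "(\<Sum>l\<in>L. s l) = 1" if L: "L \<in> \<L>" for L
  proof -
    have "(\<Sum>l\<in>L. s l) = s (r L) + (\<Sum>l\<in>L - {r L}. s l)"
      using fin[OF L] r[OF L] by (intro sum.remove) auto
    also have "(\<Sum>l\<in>L - {r L}. s l) = (\<Sum>l\<in>L - {r L}. PVar l)"
      using c_eq[OF L] by (intro sum.cong) (auto simp: s_def)
    also have "s (r L) = 1 - (\<Sum>l\<in>L - {r L}. PVar l)"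
      using r(1)[OF L] c_eq[OF L] L by (auto simp: s_def)
    finally show ?thesis
      by simp
  qed
  have "J \<subseteq> {g \<in> polys (\<Union>\<L>). psubst s g = 0}"
    unfolding J
  proof (rule Idl_minimal)
    show "?G \<subseteq> {g \<in> polys (\<Union>\<L>). psubst s g = 0}"
      using G s_gen by (auto simp: psubst_diff psubst_sum)
  qed (auto simp: poly_ideal_def psubst_zero psubst_add psubst_mult)
  then have "psubst s (PVar x * f) = 0"
    using xf by auto
  moreover have "s x = PVar x"
    using r(2)[OF c(1)[OF x]] by (simp add: s_def)
  ultimately have "psubst s f = 0"
    by (auto simp: psubst_mult intro: PVar_mult_eq_0D)
  then show ?thesis
    using psubst_cong_id[OF J_ideal s_J f] ideal_uminus[OF J_ideal] by fastforce
qed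

section \<open>Walks from the root of a tree\<close>

context rooted_tree
begin

definition walk_to :: "'v \<Rightarrow> 'e list" where
  "walk_to v = (THE w. awalk v0 w v)"

lemma awalk_walk_to: "v \<in> verts T \<Longrightarrow> awalk v0 (walk_to v) v"
  unfolding walk_to_def by (rule theI') (rule unique_walk)

lemma walk_to_eqI: "awalk v0 w v \<Longrightarrow> walk_to v = w"
  using unique_walk awalk_walk_to awalk_last_in_verts by blast

lemma walk_to_root [simp]: "walk_to v0 = []"
  using root_in_verts by (intro walk_to_eqI) (simp add: awalk_Nil_iff)

lemma walk_to_inj: "u \<in> verts T \<Longrightarrow> v \<in> verts T \<Longrightarrow> walk_to u = walk_to v \<Longrightarrow> u = v"
  using awalk_ends[of v0 "walk_to u" u v0 v] awalk_walk_to[of u] awalk_walk_to[of v] by auto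

lemma walk_to_head: "e \<in> arcs T \<Longrightarrow> walk_to (head T e) = walk_to (tail T e) @ [e]"
  by (intro walk_to_eqI awalk_appendI[OF awalk_walk_to arc_implies_awalk]) auto

text \<open>
  Every walk can be shortened to a path, and uniqueness forces the walk to be that path.
\<close>

lemma apath_walk_to: "v \<in> verts T \<Longrightarrow> apath v0 (walk_to v) v"
  using apath_awalk_to_apath[OF awalk_walk_to] walk_to_eqI[OF awalkI_apath] by metis

lemma distinct_walk_to: "v \<in> verts T \<Longrightarrow> distinct (walk_to v)"
  using apath_walk_to distinct_verts_imp_distinct by (auto simp: apath_def)

lemma set_walk_to: "v \<in> verts T \<Longrightarrow> set (walk_to v) \<subseteq> arcs T"
  using awalk_walk_to by (auto simp: awalk_def)

lemma root_leaf_paths_eq: "root_leaf_paths T v0 = walk_to ` {v \<in> verts T. out_arcs T v = {}}"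
  unfolding root_leaf_paths_def
  by (auto intro: apath_walk_to dest!: awalkI_apath walk_to_eqI)

text \<open>
  This turns statements about the vertices on a path into statements about list prefixes, for which
  children of a vertex correspond to the possible next entries.
\<close>

lemma in_awalk_verts_iff:
  assumes "awalk v0 w u"
  shows "v \<in> set (awalk_verts v0 w) \<longleftrightarrow> v \<in> verts T \<and> (\<exists>r. w = walk_to v @ r)"
proof
  assume "v \<in> set (awalk_verts v0 w)"
  then obtain q r where "w = q @ r" "awalk v0 q v"
    using awalk_decomp[OF assms] by blast
  then show "v \<in> verts T \<and> (\<exists>r. w = walk_to v @ r)"
    using walk_to_eqI awalk_last_in_verts by blast
next
  assume "v \<in> verts T \<and> (\<exists>r. w = walk_to v @ r)"
  then obtain r where v: "v \<in> verts T" and w: "w = walk_to v @ r"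
    by blast
  have "awlast v0 (walk_to v) = v"
    using awalk_walk_to[OF v] by simp
  then have "v \<in> set (awalk_verts v0 (walk_to v))"
    by (metis awalk_verts_non_Nil last_in_set)
  then show "v \<in> set (awalk_verts v0 w)"
    using set_awalk_verts_append[OF awalk_walk_to[OF v], of r u] assms w \<open>awlast v0 (walk_to v) = v\<close>
    by auto
qed

lemma leaves_to_root_induct [consumes 1, case_names step]:
  assumes "v \<in> verts T"
    and step: "\<And>v. v \<in> verts T \<Longrightarrow> (\<And>e. e \<in> out_arcs T v \<Longrightarrow> P (head T e)) \<Longrightarrow> P v"
  shows "P v"
  using assms(1)
proof (induction "card (verts T) - length (walk_to v)" arbitrary: v rule: less_induct)
  case less
  show ?case
  proof (rule step[OF less.prems])
    fix e assume e: "e \<in> out_arcs T v"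
    then have "length (walk_to (head T e)) = Suc (length (walk_to v))" and h: "head T e \<in> verts T"
      by (auto simp: walk_to_head)
    moreover have "length (walk_to (head T e)) < card (verts T)"
      using h by (intro length_apath_less[OF apath_walk_to])
    ultimately show "P (head T e)"
      by (intro less.hyps) auto
  qed
qed

lemma root_to_leaves_induct [consumes 1, case_names root step]:
  assumes "v \<in> verts T" and root: "P v0"
    and step: "\<And>e. e \<in> arcs T \<Longrightarrow> P (tail T e) \<Longrightarrow> P (head T e)"
  shows "P v"
  using assms(1)
proof (induction "walk_to v" arbitrary: v rule: rev_induct)
  case Nil
  then show ?case
    using walk_to_inj[of v v0] root root_in_verts by simp
next
  case (snoc e w)
  have "awalk v0 (w @ [e]) v"
    using awalk_walk_to snoc by metis
  then have w: "awalk v0 w (tail T e)" and e: "e \<in> arcs T" "head T e = v"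
    by (auto simp: awalk_simps)
  have "P (tail T e)"
    using walk_to_eqI[OF w] e snoc.hyps(1) by simp
  then show ?case
    using step e by blast
qed

end

section \<open>The parametrisation and the model invariants\<close>

locale indexed_staged_tree = staged_tree T v0 \<theta> stage
  for T :: "('v, 'e) pre_digraph" and v0 :: 'v and \<theta> :: "'e \<Rightarrow> 'l"
    and stage :: "('v \<times> 'v) set" +
  fixes n :: nat and ps :: "nat \<Rightarrow> 'e awalk"
  assumes ps: "bij_betw ps {1..n} (root_leaf_paths T v0)"
begin

abbreviation p :: "'v \<Rightarrow> nat rpoly" where
  "p \<equiv> p_sum T v0 n ps"

abbreviation \<phi> :: "nat rpoly \<Rightarrow> 'l rpoly" where
  "\<phi> \<equiv> psubst (\<lambda>i. \<Prod>e\<in>set (ps i). PVar (\<theta> e))"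

abbreviation I :: "nat rpoly set" where
  "I \<equiv> model_invariants T v0 \<theta> stage n ps"

abbreviation J :: "'l rpoly set" where
  "J \<equiv> sum_to_one_ideal T \<theta>"

abbreviation D :: "nat rpoly" where
  "D \<equiv> denominator_product T v0 n ps"

lemma path_is_walk_to:
  assumes "i \<in> {1..n}"
  obtains v where "v \<in> verts T" "out_arcs T v = {}" "ps i = walk_to v"
proof -
  have "ps i \<in> walk_to ` {v \<in> verts T. out_arcs T v = {}}"
    using bij_betwE[OF ps] assms unfolding root_leaf_paths_eq by blast
  then show ?thesis
    using that by blast
qed

lemma paths_through_eq:
  assumes "v \<in> verts T"
  shows "paths_through T v0 n ps v = {i \<in> {1..n}. \<exists>r. ps i = walk_to v @ r}"
proof -
  have "v \<in> set (awalk_verts v0 (ps i)) \<longleftrightarrow> (\<exists>r. ps i = walk_to v @ r)" if "i \<in> {1..n}" for i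
    using path_is_walk_to[OF that] assms in_awalk_verts_iff[OF awalk_walk_to] by metis
  then show ?thesis
    unfolding paths_through_def by auto
qed

lemma paths_through_head:
  assumes "e \<in> out_arcs T v"
  shows "paths_through T v0 n ps (head T e) = {i \<in> {1..n}. \<exists>r. ps i = walk_to v @ e # r}"
  using assms by (simp add: paths_through_eq walk_to_head)

lemma paths_through_inner:
  assumes v: "v \<in> inner_verts T"
  shows "paths_through T v0 n ps v = (\<Union>e\<in>out_arcs T v. paths_through T v0 n ps (head T e))"
proof (intro equalityI subsetI)
  have vT: "v \<in> verts T" "out_arcs T v \<noteq> {}"
    using v by (auto simp: inner_verts_def)
  fix i assume "i \<in> paths_through T v0 n ps v"
  then obtain r where i: "i \<in> {1..n}" and r: "ps i = walk_to v @ r"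
    by (auto simp: paths_through_eq[OF vT(1)])
  obtain u where u: "u \<in> verts T" "out_arcs T u = {}" "ps i = walk_to u"
    using path_is_walk_to[OF i] by blast
  have "awalk v0 (walk_to v @ r) u"
    using awalk_walk_to[OF u(1)] r u(3) by simp
  moreover have "awlast v0 (walk_to v) = v"
    using awalk_walk_to[OF vT(1)] by simp
  ultimately have w: "awalk v r u"
    by simp
  \<comment> \<open>The path does not stop at \<open>v\<close>, because it ends in a leaf.\<close>
  have "r \<noteq> []"
    using w vT(2) u(2) by (auto simp: awalk_Nil_iff)
  then obtain e s where es: "r = e # s"
    by (cases r) auto
  then have "e \<in> out_arcs T v"
    using w by (auto simp: awalk_Cons_iff)
  then show "i \<in> (\<Union>e\<in>out_arcs T v. paths_through T v0 n ps (head T e))"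
    using i r es by (auto simp: paths_through_head)
next
  fix i assume "i \<in> (\<Union>e\<in>out_arcs T v. paths_through T v0 n ps (head T e))"
  then obtain e r where "i \<in> {1..n}" "ps i = walk_to v @ e # r"
    using paths_through_head by blast
  then show "i \<in> paths_through T v0 n ps v"
    using v by (simp add: paths_through_eq inner_verts_def)
qed

text \<open>
  A path through an inner vertex continues along exactly one of the edges out of it.  This is the
  counterpart for the \<open>p\<^sub>v\<close> of the sum-to-one relations for the labels.
\<close>

lemma p_inner:
  assumes "v \<in> inner_verts T"
  shows "p v = (\<Sum>e\<in>out_arcs T v. p (head T e))"
  unfolding p_sum_def paths_through_inner[OF assms]
proof (rule sum.UNION_disjoint)
  show "\<forall>e\<in>out_arcs T v. \<forall>f\<in>out_arcs T v. e \<noteq> f \<longrightarrow>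
      paths_through T v0 n ps (head T e) \<inter> paths_through T v0 n ps (head T f) = {}"
    by (auto simp: paths_through_head)
qed (auto simp: paths_through_def)

lemma paths_through_leaf:
  assumes v: "v \<in> verts T" "out_arcs T v = {}" and i: "i \<in> {1..n}" "ps i = walk_to v"
  shows "paths_through T v0 n ps v = {i}"
proof -
  have "j = i" if j: "j \<in> {1..n}" and r: "ps j = walk_to v @ r" for j r
  proof -
    obtain u where u: "u \<in> verts T" "ps j = walk_to u"
      using path_is_walk_to[OF j] by blast
    have "awalk v0 (walk_to v @ r) u"
      using awalk_walk_to[OF u(1)] r u(2) by simp
    moreover have "awlast v0 (walk_to v) = v"
      using awalk_walk_to[OF v(1)] by simp
    ultimately have "awalk v r u"
      by simp
    then have "r = []"
      using v(2) by (cases r) (auto simp: awalk_Cons_iff)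
    then show ?thesis
      using inj_onD[OF bij_betw_imp_inj_on[OF ps]] i j r by simp
  qed
  moreover have "\<exists>r. ps i = walk_to v @ r"
    using i by simp
  ultimately show ?thesis
    unfolding paths_through_eq[OF v(1)] using i(1) by blast
qed

lemma p_leaf:
  assumes "v \<in> verts T" "out_arcs T v = {}" "i \<in> {1..n}" "ps i = walk_to v"
  shows "p v = PVar i"
  using paths_through_leaf[OF assms] by (simp add: p_sum_def)

lemma leaf_is_path:
  assumes "v \<in> verts T" "out_arcs T v = {}"
  obtains i where "i \<in> {1..n}" "ps i = walk_to v"
proof -
  have "walk_to v \<in> ps ` {1..n}"
    using assms unfolding bij_betw_imp_surj_on[OF ps] root_leaf_paths_eq by simp
  then show ?thesis
    using that by force
qed

lemma p_in_polys: "p v \<in> polys {1..n}"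
  unfolding p_sum_def by (intro polys_sum polys_PVar) (auto simp: paths_through_def)

lemma homog_p: "homog 1 (p v)"
  unfolding p_sum_def by (intro homog_sum homog_PVar)

lemma finite_inner_verts: "finite (inner_verts T)"
  by (simp add: inner_verts_def)

lemma D_in_polys: "D \<in> polys {1..n}"
  unfolding denominator_product_def by (intro polys_prod p_in_polys)

lemma homog_D: "homog (card (inner_verts T)) D"
  using homog_prod[OF finite_inner_verts homog_p] by (simp add: denominator_product_def)

lemma inner_vertsI: "e \<in> out_arcs T v \<Longrightarrow> v \<in> inner_verts T"
  by (auto simp: inner_verts_def)

lemma same_label_same_stage:
  assumes "e \<in> arcs T" "f \<in> arcs T" "\<theta> e = \<theta> f"
  shows "(tail T e, tail T f) \<in> stage"
  using labels_other_stage[of "tail T e" "tail T f"] inner_vertsI assms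
  by (metis disjoint_iff imageI in_out_arcs_conv)

text \<open>
  The exponent vector of the product of the labels on the walk to \<open>v\<close>.
\<close>

definition walk_monomial :: "'v \<Rightarrow> 'l \<Rightarrow>\<^sub>0 nat" where
  "walk_monomial v = (\<Sum>e\<in>set (walk_to v). Poly_Mapping.single (\<theta> e) 1)"

lemma walk_monomial_root: "walk_monomial v0 = 0"
  by (simp add: walk_monomial_def)

lemma walk_monomial_head:
  assumes "e \<in> arcs T"
  shows "walk_monomial (head T e) = Poly_Mapping.single (\<theta> e) 1 + walk_monomial (tail T e)"
proof -
  have "e \<notin> set (walk_to (tail T e))"
    using distinct_walk_to[of "head T e"] assms by (simp add: walk_to_head)
  then show ?thesis
    using assms by (simp add: walk_monomial_def walk_to_head)
qed

lemma keys_walk_monomial: "v \<in> verts T \<Longrightarrow> Poly_Mapping.keys (walk_monomial v) \<subseteq> \<theta> ` arcs T"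
  by (induction rule: root_to_leaves_induct)
    (auto simp: walk_monomial_root walk_monomial_head keys_monomial_add)

lemma \<phi>_PVar:
  assumes "ps i = walk_to v"
  shows "(\<Prod>e\<in>set (ps i). PVar (\<theta> e)) = Poly_Mapping.single (walk_monomial v) 1"
proof -
  have "(\<Prod>e\<in>E. PVar (\<theta> e))
      = (Poly_Mapping.single (\<Sum>e\<in>E. Poly_Mapping.single (\<theta> e) 1) 1 :: 'l rpoly)" for E
    by (induction E rule: infinite_finite_induct) (simp_all add: PVar_def mult_single)
  then show ?thesis
    by (simp add: assms walk_monomial_def)
qed

lemma \<phi>_in_polys: "f \<in> polys {1..n} \<Longrightarrow> \<phi> f \<in> polys (\<theta> ` arcs T)"
proof (erule psubst_in_polys)
  fix i assume "i \<in> {1..n}"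
  then obtain v where "v \<in> verts T" "ps i = walk_to v"
    by (rule path_is_walk_to)
  then show "(\<Prod>e\<in>set (ps i). PVar (\<theta> e)) \<in> polys (\<theta> ` arcs T)"
    using set_walk_to by (intro polys_prod polys_PVar) auto
qed

lemma label_ring_eq [simp]: "label_ring T \<theta> = poly_ring (\<theta> ` arcs T)"
  by (simp add: label_ring_def)

lemma J_generators:
  "{(\<Sum>e\<in>out_arcs T v. PVar (\<theta> e)) - 1 | v. v \<in> inner_verts T} \<subseteq> polys (\<theta> ` arcs T)"
  by (auto intro!: polys_diff polys_sum polys_PVar)

lemma poly_ideal_J: "poly_ideal (\<theta> ` arcs T) J"
  unfolding sum_to_one_ideal_def using Idl_poly_ideal[OF J_generators] by simp

lemma sum_labels_J: "v \<in> inner_verts T \<Longrightarrow> (\<Sum>e\<in>out_arcs T v. PVar (\<theta> e)) - 1 \<in> J"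
  unfolding sum_to_one_ideal_def using Idl_generator[OF J_generators] by auto

lemma I_generators:
  "{p v * p (head T f) - p (head T e) * p w | v w e f.
      (v, w) \<in> stage \<and> e \<in> out_arcs T v \<and> f \<in> out_arcs T w \<and> \<theta> e = \<theta> f} \<subseteq> polys {1..n}"
  using p_in_polys by blast

lemma poly_ideal_I: "poly_ideal {1..n} I"
  unfolding model_invariants_def using Idl_poly_ideal[OF I_generators] by simp

lemma model_invariant_in_I:
  assumes "e \<in> arcs T" "f \<in> arcs T" "\<theta> e = \<theta> f"
  shows "p (tail T e) * p (head T f) - p (head T e) * p (tail T f) \<in> I"
  unfolding model_invariants_def using assms same_label_same_stage[OF assms]
  by (intro Idl_generator[OF I_generators]) force

lemma hom_kernel_eq:
  "hom_kernel T \<theta> n ps = Idl\<^bsub>poly_ring {1..n}\<^esub> {f \<in> polys {1..n}. \<phi> f \<in> J \<and> homogeneous f}"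
proof -
  have "path_hom T \<theta> ps f = J \<longleftrightarrow> \<phi> f \<in> J" if "f \<in> polys {1..n}" for f
    using coset_eq_ideal_iff[OF poly_ideal_J \<phi>_in_polys[OF that]] by (simp add: path_hom_def)
  then show ?thesis
    unfolding hom_kernel_def a_kernel_def' FactRing_def
    by (intro arg_cong[where f = "\<lambda>G. Idl\<^bsub>poly_ring {1..n}\<^esub> G"]) auto
qed

section \<open>The saturation lies in the kernel\<close>

text \<open>
  At a leaf, \<open>p\<^sub>v\<close> is the indeterminate of a path and its image is the walk monomial itself.  At an inner
  vertex the walk monomials of the children add up to the one of \<open>v\<close> times the sum of the labels out of
  \<open>v\<close>, which is \<open>1\<close> modulo \<open>J\<close>.
\<close>

lemma \<phi>_p:
  assumes "v \<in> verts T"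
  shows "\<phi> (p v) - Poly_Mapping.single (walk_monomial v) 1 \<in> J"
  using assms
proof (induction rule: leaves_to_root_induct)
  case (step v)
  let ?m = "\<lambda>v. Poly_Mapping.single (walk_monomial v) 1 :: 'l rpoly"
  show ?case
  proof (cases "out_arcs T v = {}")
    case True
    then obtain i where "i \<in> {1..n}" "ps i = walk_to v"
      using leaf_is_path step.hyps by blast
    then show ?thesis
      using p_leaf[OF step.hyps True] \<phi>_PVar by (simp add: ideal_zero[OF poly_ideal_J])
  next
    case False
    then have v: "v \<in> inner_verts T"
      using step.hyps by (simp add: inner_verts_def)
    have "\<phi> (p v) - (\<Sum>e\<in>out_arcs T v. ?m (head T e)) \<in> J"
      unfolding p_inner[OF v] psubst_sum by (intro ideal_cong_sum[OF poly_ideal_J] step.IH)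
    moreover have "(\<Sum>e\<in>out_arcs T v. ?m (head T e)) = (\<Sum>e\<in>out_arcs T v. PVar (\<theta> e)) * ?m v"
      unfolding sum_distrib_right
      by (intro sum.cong) (auto simp: walk_monomial_head PVar_def mult_single)
    moreover have "(\<Sum>e\<in>out_arcs T v. PVar (\<theta> e)) * ?m v - 1 * ?m v \<in> J"
      unfolding left_diff_distrib[symmetric]
      using keys_walk_monomial[OF step.hyps]
      by (intro ideal_mult_right[OF poly_ideal_J sum_labels_J[OF v]] polys_single)
    ultimately show ?thesis
      using ideal_cong_trans[OF poly_ideal_J, of "\<phi> (p v)" _ "?m v"] by (simp only: mult_1_left)
  qed
qed

text \<open>
  By \<open>\<phi>_p\<close> both products in an invariant are mapped to the walk monomials of \<open>v\<close> and \<open>w\<close> times the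
  common label of the two edges.
\<close>

lemma \<phi>_I:
  assumes "f \<in> I"
  shows "\<phi> f \<in> J"
proof -
  let ?m = "\<lambda>v. Poly_Mapping.single (walk_monomial v) 1 :: 'l rpoly"
  let ?K = "{f \<in> polys {1..n}. \<phi> f \<in> J}"
  have "I \<subseteq> ?K"
    unfolding model_invariants_def
  proof (rule Idl_minimal)
    show "poly_ideal {1..n} ?K"
      unfolding poly_ideal_def
    proof (intro conjI ballI)
      fix a c assume "a \<in> ?K" "c \<in> polys {1..n}"
      then show "c * a \<in> ?K"
        using ideal_mult_left[OF poly_ideal_J _ \<phi>_in_polys] by (simp add: psubst_mult polys_mult)
    qed (auto simp: psubst_zero psubst_add ideal_zero[OF poly_ideal_J] intro: ideal_add[OF poly_ideal_J])
    have gen: "\<phi> (p v * p (head T f) - p (head T e) * p w) \<in> J"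
      if *: "(v, w) \<in> stage" "e \<in> out_arcs T v" "f \<in> out_arcs T w" "\<theta> e = \<theta> f" for v w e f
    proof -
      have verts: "v \<in> verts T" "w \<in> verts T" "head T e \<in> verts T" "head T f \<in> verts T"
        using * by auto
      have m: "?m u \<in> polys (\<theta> ` arcs T)" if "u \<in> verts T" for u
        using keys_walk_monomial[OF that] by (rule polys_single)
      have mult: "\<phi> (p u) * \<phi> (p u') - ?m u * ?m u' \<in> J" if "u \<in> verts T" "u' \<in> verts T" for u u'
        by (rule ideal_cong_mult[OF poly_ideal_J \<phi>_p[OF that(1)] \<phi>_p[OF that(2)] m[OF that(1)]
              \<phi>_in_polys[OF p_in_polys]])
      have "?m v * ?m (head T f) = ?m (head T e) * ?m w"
        using * by (simp add: walk_monomial_head mult_single add_ac)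
      then have "?m v * ?m (head T f) - \<phi> (p (head T e)) * \<phi> (p w) \<in> J"
        using ideal_cong_sym[OF poly_ideal_J mult[OF verts(3,2)]] by simp
      then show ?thesis
        unfolding psubst_diff psubst_mult
        by (rule ideal_cong_trans[OF poly_ideal_J mult[OF verts(1,4)]])
    qed
    show "{p v * p (head T f) - p (head T e) * p w | v w e f.
        (v, w) \<in> stage \<and> e \<in> out_arcs T v \<and> f \<in> out_arcs T w \<and> \<theta> e = \<theta> f} \<subseteq> ?K"
      using gen I_generators by blast
  qed
  then show ?thesis
    using assms by blast
qed

text \<open>
  The label sets of the stages are disjoint and have at least two elements by the axioms of a staged
  tree, so the labels are cancellable by \<open>PVar_mult_mem_sum_to_one_IdlD\<close>.
\<close>

lemma label_cancel_J:
  assumes l: "l \<in> \<theta> ` arcs T" and f: "f \<in> polys (\<theta> ` arcs T)" and "PVar l * f \<in> J"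
  shows "f \<in> J"
proof -
  let ?\<L> = "{\<theta> ` out_arcs T v | v. v \<in> inner_verts T}"
  have Un: "\<theta> ` arcs T = \<Union>?\<L>"
    by (auto intro!: inner_vertsI) (metis imageI in_out_arcs_conv inner_vertsI)
  have sum_eq: "(\<Sum>l\<in>\<theta> ` out_arcs T v. PVar l) = (\<Sum>e\<in>out_arcs T v. PVar (\<theta> e) :: 'l rpoly)"
    if "v \<in> inner_verts T" for v
    using labels_distinct that by (simp add: inner_verts_def sum.reindex)
  show ?thesis
  proof (rule PVar_mult_mem_sum_to_one_IdlD[of ?\<L> J l f])
    fix L assume "L \<in> ?\<L>"
    then obtain v where v: "v \<in> inner_verts T" "L = \<theta> ` out_arcs T v"
      by blast
    have "card L = out_degree T v"
      using v labels_distinct by (simp add: inner_verts_def card_image out_degree_def)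
    moreover have fin: "finite (out_arcs T v)"
      by (rule finite_subset[OF _ finite_arcs]) auto
    moreover have "out_degree T v \<noteq> 0"
      using v fin by (simp add: inner_verts_def out_degree_def)
    ultimately show "finite L \<and> 2 \<le> card L"
      using v out_degree_cases[of v] by (auto simp: inner_verts_def)
  next
    fix L M assume "L \<in> ?\<L>" "M \<in> ?\<L>" "L \<noteq> M"
    then show "L \<inter> M = {}"
      using labels_same_stage labels_other_stage by blast
  next
    have "{(\<Sum>l\<in>L. PVar l) - 1 | L. L \<in> ?\<L>}
        = {(\<Sum>e\<in>out_arcs T v. PVar (\<theta> e)) - (1 :: 'l rpoly) | v. v \<in> inner_verts T}"
      unfolding setcompr_eq_image Collect_mem_eq image_image
      by (rule image_cong) (simp_all add: sum_eq)
    then show "J = Idl\<^bsub>poly_ring (\<Union>?\<L>)\<^esub> {(\<Sum>l\<in>L. PVar l) - 1 | L. L \<in> ?\<L>}"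
      unfolding sum_to_one_ideal_def by (simp flip: Un)
  qed (use assms in \<open>simp_all flip: Un\<close>)
qed

lemma monomial_cancel_J:
  assumes "Poly_Mapping.keys m \<subseteq> \<theta> ` arcs T" "f \<in> polys (\<theta> ` arcs T)"
    and "Poly_Mapping.single m 1 * f \<in> J"
  shows "f \<in> J"
  using assms
proof (induction rule: monomial_induct)
  case (var x m)
  have "PVar x * (Poly_Mapping.single m 1 * f) = Poly_Mapping.single (Poly_Mapping.single x 1 + m) 1 * f"
    unfolding PVar_def mult.assoc[symmetric] mult_single by simp
  then have "PVar x * (Poly_Mapping.single m 1 * f) \<in> J"
    using var.prems(2) by simp
  then have "Poly_Mapping.single m 1 * f \<in> J"
    using label_cancel_J[OF var.hyps(1) polys_mult[OF polys_single[OF var.hyps(2)] var.prems(1)]]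
    by blast
  then show ?case
    by (rule var.IH[OF var.prems(1)])
qed simp

lemma p_cancel_J:
  assumes v: "v \<in> verts T" and f: "f \<in> polys (\<theta> ` arcs T)" and "\<phi> (p v) * f \<in> J"
  shows "f \<in> J"
proof -
  have "(\<phi> (p v) - Poly_Mapping.single (walk_monomial v) 1) * f \<in> J"
    by (rule ideal_mult_right[OF poly_ideal_J \<phi>_p[OF v] f])
  then have "Poly_Mapping.single (walk_monomial v) 1 * f \<in> J"
    unfolding left_diff_distrib using assms(3) ideal_cong_mem[OF poly_ideal_J] by blast
  then show ?thesis
    using monomial_cancel_J keys_walk_monomial[OF v] f by blast
qed

lemma D_cancel_J:
  assumes "f \<in> polys (\<theta> ` arcs T)" and "\<phi> (D ^ k) * f \<in> J"
  shows "f \<in> J"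
proof -
  have prod: "g \<in> J" if "A \<subseteq> verts T" "g \<in> polys (\<theta> ` arcs T)" "\<phi> (\<Prod>v\<in>A. p v) * g \<in> J" for A g
    using that
  proof (induction A arbitrary: g rule: infinite_finite_induct)
    case (insert v A)
    then have "\<phi> (p v) * (\<phi> (\<Prod>v\<in>A. p v) * g) \<in> J"
      by (simp add: psubst_mult mult.assoc)
    moreover have "\<phi> (\<Prod>v\<in>A. p v) * g \<in> polys (\<theta> ` arcs T)"
      using insert.prems(2) by (intro polys_mult \<phi>_in_polys polys_prod p_in_polys)
    ultimately have "\<phi> (\<Prod>v\<in>A. p v) * g \<in> J"
      using p_cancel_J insert.prems(1) by blast
    then show ?case
      using insert by blast
  qed simp_all
  show ?thesis
    using assms
  proof (induction k)
    case (Suc k)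
    have "\<phi> (\<Prod>v\<in>inner_verts T. p v) * (\<phi> (D ^ k) * f) \<in> J"
      using Suc.prems(2) by (simp add: psubst_mult mult.assoc denominator_product_def)
    then have "\<phi> (D ^ k) * f \<in> J"
      using prod[of "inner_verts T", OF _ polys_mult[OF \<phi>_in_polys[OF polys_power[OF D_in_polys]]
            Suc.prems(1)]]
      by (auto simp: inner_verts_def)
    then show ?case
      using Suc by blast
  qed simp
qed

text \<open>
  The kernel ideal is generated by homogeneous elements only, so membership has to be shown for
  each homogeneous component of \<open>f\<close>.
\<close>

lemma saturation_subset_hom_kernel:
  "saturation (poly_ring {1..n}) I D \<subseteq> hom_kernel T \<theta> n ps"
proof
  fix f assume "f \<in> saturation (poly_ring {1..n}) I D"
  then obtain k where f: "f \<in> polys {1..n}" and k: "D ^ k * f \<in> I"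
    by (auto simp: saturation_poly_ring)
  let ?G = "{f \<in> polys {1..n}. \<phi> f \<in> J \<and> homogeneous f}"
  have "hcomp d f \<in> ?G" for d
  proof -
    let ?c = "k * card (inner_verts T)"
    have "hcomp (?c + d) (D ^ k * f) \<in> I"
      unfolding model_invariants_def
    proof (rule hcomp_in_homogeneous_Idl[OF I_generators])
      fix g
      assume "g \<in> {p v * p (head T f) - p (head T e) * p w | v w e f.
          (v, w) \<in> stage \<and> e \<in> out_arcs T v \<and> f \<in> out_arcs T w \<and> \<theta> e = \<theta> f}"
      then show "homogeneous g"
        unfolding homogeneous_iff by (auto intro!: homog_diff homog_mult homog_p exI)
    qed (use k in \<open>simp add: model_invariants_def\<close>)
    then have "D ^ k * hcomp d f \<in> I"
      by (simp add: hcomp_homog_mult[OF homog_power[OF homog_D]])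
    then have "\<phi> (D ^ k) * \<phi> (hcomp d f) \<in> J"
      using \<phi>_I by (simp flip: psubst_mult)
    then show ?thesis
      using D_cancel_J[OF \<phi>_in_polys] hcomp_in_polys[OF f] homog_hcomp homogeneous_iff by blast
  qed
  moreover obtain N where "\<And>m. m \<in> Poly_Mapping.keys f \<Longrightarrow> mdeg m \<le> N"
    by (meson Max_ge finite_imageI finite_keys imageI)
  moreover have G: "?G \<subseteq> polys {1..n}"
    by blast
  ultimately have "f = (\<Sum>d\<le>N. hcomp d f)" "\<And>d. hcomp d f \<in> hom_kernel T \<theta> n ps"
    unfolding hom_kernel_eq by (blast intro: sum_hcomp, blast intro: Idl_generator[OF G])
  moreover have "poly_ideal {1..n} (hom_kernel T \<theta> n ps)"
    unfolding hom_kernel_eq by (rule Idl_poly_ideal[OF G])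
  ultimately show "f \<in> hom_kernel T \<theta> n ps"
    using ideal_sum by metis
qed

section \<open>The kernel lies in the saturation\<close>

text \<open>
  This is \<open>D\<close> times the quotient of \<open>p (head T e)\<close> and \<open>p (tail T e)\<close>, written without a denominator.
\<close>

definition cleared_ratio :: "'e \<Rightarrow> nat rpoly" where
  "cleared_ratio e = p (head T e) * (\<Prod>u\<in>inner_verts T - {tail T e}. p u)"

text \<open>
  Modulo \<open>I\<close> the choice of the edge does not matter, see \<open>cleared_ratio_cong\<close>.
\<close>

definition label_lift :: "'l \<Rightarrow> nat rpoly" where
  "label_lift l = cleared_ratio (SOME e. e \<in> arcs T \<and> \<theta> e = l)"

lemma cleared_ratio_in_polys: "cleared_ratio e \<in> polys {1..n}"
  unfolding cleared_ratio_def by (intro polys_mult polys_prod p_in_polys)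

lemma label_lift_in_polys: "label_lift l \<in> polys {1..n}"
  unfolding label_lift_def by (rule cleared_ratio_in_polys)

lemma D_eq:
  assumes "v \<in> inner_verts T"
  shows "D = p v * (\<Prod>u\<in>inner_verts T - {v}. p u)"
  unfolding denominator_product_def using finite_inner_verts assms by (rule prod.remove)

lemma tail_cleared_ratio:
  assumes "e \<in> arcs T"
  shows "p (tail T e) * cleared_ratio e = D * p (head T e)"
  using D_eq[of "tail T e"] inner_vertsI[of e "tail T e"] assms by (simp add: cleared_ratio_def mult_ac)

lemma sum_cleared_ratio:
  assumes "v \<in> inner_verts T"
  shows "(\<Sum>e\<in>out_arcs T v. cleared_ratio e) = D"
  using D_eq[OF assms] p_inner[OF assms] by (simp add: cleared_ratio_def sum_distrib_right)

lemma cleared_ratio_cong: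
  assumes e: "e \<in> arcs T" and f: "f \<in> arcs T" and "\<theta> e = \<theta> f"
  shows "cleared_ratio e - cleared_ratio f \<in> I"
proof (cases "tail T e = tail T f")
  case True
  then have "e = f"
    using labels_distinct[of "tail T e"] assms by (auto simp: inj_on_def)
  then show ?thesis
    by (simp add: ideal_zero[OF poly_ideal_I])
next
  case False
  let ?v = "tail T e" and ?w = "tail T f"
  \<comment> \<open>Up to sign, the difference is a model invariant times the remaining denominators.\<close>
  let ?q = "\<Prod>u\<in>inner_verts T - {?v, ?w}. p u"
  have vw: "?v \<in> inner_verts T" "?w \<in> inner_verts T"
    using e f by (auto intro: inner_vertsI)
  have "(\<Prod>u\<in>inner_verts T - {?v}. p u) = p ?w * ?q"
    using False vw finite_inner_verts
    by (subst prod.remove[of _ ?w]) (auto intro!: arg_cong2[where f = "(*)"] prod.cong)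
  moreover have "(\<Prod>u\<in>inner_verts T - {?w}. p u) = p ?v * ?q"
    using False vw finite_inner_verts
    by (subst prod.remove[of _ ?v]) (auto intro!: arg_cong2[where f = "(*)"] prod.cong)
  ultimately have "cleared_ratio e - cleared_ratio f = - (p ?v * p (head T f) - p (head T e) * p ?w) * ?q"
    by (simp add: cleared_ratio_def algebra_simps)
  also have "\<dots> \<in> I"
    by (intro ideal_mult_right[OF poly_ideal_I] ideal_uminus[OF poly_ideal_I]
        model_invariant_in_I assms polys_prod p_in_polys)
  finally show ?thesis .
qed

lemma label_lift_cong:
  assumes "e \<in> arcs T"
  shows "label_lift (\<theta> e) - cleared_ratio e \<in> I"
proof -
  have "(SOME f. f \<in> arcs T \<and> \<theta> f = \<theta> e) \<in> arcs T \<and> \<theta> (SOME f. f \<in> arcs T \<and> \<theta> f = \<theta> e) = \<theta> e"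
    by (rule someI_ex) (use assms in blast)
  then show ?thesis
    unfolding label_lift_def using cleared_ratio_cong assms by blast
qed

lemma tail_label_lift:
  assumes "e \<in> arcs T"
  shows "p (tail T e) * label_lift (\<theta> e) - D * p (head T e) \<in> I"
  unfolding tail_cleared_ratio[OF assms, symmetric] right_diff_distrib[symmetric]
  by (intro ideal_mult_left[OF poly_ideal_I label_lift_cong[OF assms] p_in_polys])

lemma sum_label_lift:
  assumes "v \<in> inner_verts T"
  shows "(\<Sum>e\<in>out_arcs T v. label_lift (\<theta> e)) - D \<in> I"
  unfolding sum_cleared_ratio[OF assms, symmetric]
  by (intro ideal_cong_sum[OF poly_ideal_I] label_lift_cong) auto

text \<open>
  The quotients along the walk telescope: each edge trades the factor \<open>p\<close> of its tail for \<open>D\<close> times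
  \<open>p\<close> of its head.  The factor \<open>p v0\<close> starts the telescope.
\<close>

lemma meval_label_lift_walk_monomial:
  assumes "v \<in> verts T"
  shows "p v0 * meval label_lift (walk_monomial v) - D ^ mdeg (walk_monomial v) * p v \<in> I"
  using assms
proof (induction rule: root_to_leaves_induct)
  case root
  then show ?case
    by (simp add: walk_monomial_root ideal_zero[OF poly_ideal_I])
next
  case (step e)
  let ?t = "walk_monomial (tail T e)"
  have "(p v0 * meval label_lift ?t - D ^ mdeg ?t * p (tail T e)) * label_lift (\<theta> e) \<in> I"
    by (intro ideal_mult_right[OF poly_ideal_I step.IH label_lift_in_polys])
  moreover have "D ^ mdeg ?t * (p (tail T e) * label_lift (\<theta> e) - D * p (head T e)) \<in> I"
    by (intro ideal_mult_left[OF poly_ideal_I tail_label_lift[OF step.hyps]] polys_power D_in_polys)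
  ultimately have "(p v0 * meval label_lift ?t - D ^ mdeg ?t * p (tail T e)) * label_lift (\<theta> e)
      + D ^ mdeg ?t * (p (tail T e) * label_lift (\<theta> e) - D * p (head T e)) \<in> I"
    by (rule ideal_add[OF poly_ideal_I])
  then show ?case
    using step.hyps by (simp add: walk_monomial_head meval_add algebra_simps)
qed

text \<open>
  The images of the \<open>p\<^sub>i\<close> are monomials in the labels, so the image of a monomial \<open>m\<close> is again a single
  monomial \<open>M\<close>, and the telescoping congruences of its factors multiply.  The degree of \<open>M\<close> depends on the
  lengths of the paths, whereas the power of \<open>p v0\<close> depends only on the degree of \<open>m\<close>.
\<close>

lemma label_lift_\<phi>_monomial:
  assumes "Poly_Mapping.keys m \<subseteq> {1..n}"
  shows "\<exists>M. meval (\<lambda>i. \<Prod>e\<in>set (ps i). PVar (\<theta> e)) m = Poly_Mapping.single M 1 \<and>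
    p v0 ^ mdeg m * meval label_lift M - D ^ mdeg M * Poly_Mapping.single m 1 \<in> I"
  using assms
proof (induction rule: monomial_induct)
  case zero
  show ?case
    by (rule exI[of _ 0]) (simp add: ideal_zero[OF poly_ideal_I])
next
  case (var i m)
  then obtain M where M:
    "meval (\<lambda>i. \<Prod>e\<in>set (ps i). PVar (\<theta> e)) m = Poly_Mapping.single M 1"
    "p v0 ^ mdeg m * meval label_lift M - D ^ mdeg M * Poly_Mapping.single m 1 \<in> I"
    by blast
  obtain v where v: "v \<in> verts T" "out_arcs T v = {}" "ps i = walk_to v"
    using path_is_walk_to var.hyps(1) by blast
  have "p v0 * meval label_lift (walk_monomial v) - D ^ mdeg (walk_monomial v) * PVar i \<in> I"
    using meval_label_lift_walk_monomial[OF v(1)] p_leaf[OF v(1,2) var.hyps(1) v(3)] by simp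
  then have "(p v0 * meval label_lift (walk_monomial v)) * (p v0 ^ mdeg m * meval label_lift M)
      - (D ^ mdeg (walk_monomial v) * PVar i) * (D ^ mdeg M * Poly_Mapping.single m 1) \<in> I"
    using M(2)
  proof (rule ideal_cong_mult[OF poly_ideal_I])
    have "D ^ mdeg M * Poly_Mapping.single m 1 \<in> polys {1..n}"
      using var.hyps by (intro polys_mult polys_power D_in_polys polys_single)
    then show "p v0 ^ mdeg m * meval label_lift M \<in> polys {1..n}"
      using polys_add[OF ideal_sub[OF poly_ideal_I M(2)]] by fastforce
  qed (intro polys_mult polys_power D_in_polys polys_PVar var.hyps)
  moreover have "Poly_Mapping.single (Poly_Mapping.single i 1 + m) 1
      = PVar i * (Poly_Mapping.single m 1 :: nat rpoly)"
    by (simp add: PVar_def mult_single)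
  ultimately have "p v0 ^ mdeg (Poly_Mapping.single i 1 + m) * meval label_lift (walk_monomial v + M)
      - D ^ mdeg (walk_monomial v + M) * Poly_Mapping.single (Poly_Mapping.single i 1 + m) 1 \<in> I"
    by (simp add: meval_add power_add mult_ac)
  moreover have "meval (\<lambda>i. \<Prod>e\<in>set (ps i). PVar (\<theta> e)) (Poly_Mapping.single i 1 + m)
      = Poly_Mapping.single (walk_monomial v + M) 1"
    using M(1) \<phi>_PVar[OF v(3)] by (simp add: meval_add mult_single)
  ultimately show ?case
    by blast
qed

text \<open>
  \<open>D\<close> plays the role of the homogenizing variable: a lifted label is \<open>D\<close> times a quotient, so this
  is \<open>D\<^sup>N\<close> times the value of the polynomial at the quotients.  The reading is valid
  only if \<open>N\<close> is at least the degree of the polynomial, because of the truncated subtraction.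
\<close>

definition homogenized_lift :: "nat \<Rightarrow> 'l rpoly \<Rightarrow> nat rpoly" where
  "homogenized_lift N = lin (\<lambda>M. D ^ (N - mdeg M) * meval label_lift M)"

text \<open>
  The exponents of \<open>D\<close> agree because truncated subtraction satisfies \<open>N - (a + b) = (N - a) - b\<close>
  for all natural numbers.
\<close>

lemma homogenized_lift_monomial_mult:
  "homogenized_lift N (Poly_Mapping.single M c * g)
    = PConst c * meval label_lift M * homogenized_lift (N - mdeg M) g"
proof -
  have "g \<in> polys UNIV"
    by (simp add: polys_iff)
  then show ?thesis
    by (induction rule: polys_induct)
      (simp_all add: homogenized_lift_def mult_single lin_single lin_add distrib_left distrib_right
        PConst_mult meval_add mult_ac add_ac)
qed

text \<open>
  A generator of \<open>J\<close> lifts to a power of \<open>D\<close> times \<open>(\<Sum>e. label_lift (\<theta> e)) - D\<close>, which lies in \<open>I\<close>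
  by \<open>sum_label_lift\<close>.  The degree bound \<open>N0\<close> grows with the monomials that the generators are multiplied by.
\<close>

lemma homogenized_lift_J:
  assumes "g \<in> J"
  shows "\<exists>N0. \<forall>N\<ge>N0. homogenized_lift N g \<in> I"
proof -
  let ?K = "{g \<in> polys (\<theta> ` arcs T). \<exists>N0. \<forall>N\<ge>N0. homogenized_lift N g \<in> I}"
  have add: "\<exists>N0. \<forall>N\<ge>N0. homogenized_lift N (f + g) \<in> I"
    if "\<exists>N0. \<forall>N\<ge>N0. homogenized_lift N f \<in> I" "\<exists>N0. \<forall>N\<ge>N0. homogenized_lift N g \<in> I" for f g
  proof -
    from that obtain N1 N2 where
      "\<forall>N\<ge>N1. homogenized_lift N f \<in> I" "\<forall>N\<ge>N2. homogenized_lift N g \<in> I"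
      by blast
    then have "\<forall>N\<ge>max N1 N2. homogenized_lift N (f + g) \<in> I"
      by (auto simp: homogenized_lift_def lin_add intro: ideal_add[OF poly_ideal_I])
    then show ?thesis
      by blast
  qed
  have "J \<subseteq> ?K"
    unfolding sum_to_one_ideal_def label_ring_eq
  proof (rule Idl_minimal)
    show "poly_ideal (\<theta> ` arcs T) ?K"
      unfolding poly_ideal_def
    proof (intro conjI ballI)
      fix g c assume g: "g \<in> ?K" and "c \<in> polys (\<theta> ` arcs T)"
      from this(2) show "c * g \<in> ?K"
      proof (induction rule: polys_induct)
        case (monomial M c)
        obtain N0 where N0: "\<And>N. N0 \<le> N \<Longrightarrow> homogenized_lift N g \<in> I"
          using g by blast
        have "homogenized_lift N (Poly_Mapping.single M c * g) \<in> I" if "N0 + mdeg M \<le> N" for N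
          unfolding homogenized_lift_monomial_mult using monomial that label_lift_in_polys
          by (intro ideal_mult_left[OF poly_ideal_I] N0 polys_mult meval_in_polys[of M]) auto
        then show ?case
          using g monomial by blast
      qed (use add in \<open>auto simp: distrib_right\<close>)
    qed (use add in \<open>auto simp: homogenized_lift_def ideal_zero[OF poly_ideal_I]\<close>)
    have "homogenized_lift N ((\<Sum>e\<in>out_arcs T v. PVar (\<theta> e)) - 1) \<in> I"
      if v: "v \<in> inner_verts T" and N: "1 \<le> N" for v N
    proof -
      have "homogenized_lift N ((\<Sum>e\<in>out_arcs T v. PVar (\<theta> e)) - 1)
          = D ^ (N - 1) * (\<Sum>e\<in>out_arcs T v. label_lift (\<theta> e)) - D ^ N"
        using lin_single[of "\<lambda>M. D ^ (N - mdeg M) * meval label_lift M" 0 1]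
        by (simp add: homogenized_lift_def lin_diff lin_sum PVar_def lin_single sum_distrib_left)
      also have "D ^ N = D ^ (N - 1) * D"
        using N by (metis power_minus_mult zero_less_one less_le_trans)
      finally show ?thesis
        using ideal_mult_left[OF poly_ideal_I sum_label_lift[OF v] polys_power[OF D_in_polys, of "N - 1"]]
        by (simp add: right_diff_distrib)
    qed
    then show "{(\<Sum>e\<in>out_arcs T v. PVar (\<theta> e)) - 1 | v. v \<in> inner_verts T} \<subseteq> ?K"
      using J_generators by blast
  qed
  then show ?thesis
    using assms by blast
qed

text \<open>
  Homogeneity of \<open>f\<close> is what lets a single factor \<open>p v0 ^ d\<close> serve all monomials at once: modulo \<open>I\<close>
  it turns the lift of \<open>\<phi> f\<close> into \<open>D ^ N * f\<close>.
\<close>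

lemma homogeneous_kernel_in_saturation:
  assumes f: "f \<in> polys {1..n}" and d: "homog d f" and "\<phi> f \<in> J"
  shows "\<exists>N. D ^ N * f \<in> I"
proof -
  let ?g = "\<lambda>i. \<Prod>e\<in>set (ps i). PVar (\<theta> e) :: 'l rpoly"
  obtain N0 where N0: "\<And>N. N0 \<le> N \<Longrightarrow> homogenized_lift N (\<phi> f) \<in> I"
    using homogenized_lift_J[OF assms(3)] by blast
  have "\<forall>m\<in>Poly_Mapping.keys f. \<exists>M. meval ?g m = Poly_Mapping.single M 1 \<and>
      p v0 ^ mdeg m * meval label_lift M - D ^ mdeg M * Poly_Mapping.single m 1 \<in> I"
    using label_lift_\<phi>_monomial f by (simp add: polys_iff del: atLeastAtMost_iff)
  then obtain M where M: "\<And>m. m \<in> Poly_Mapping.keys f \<Longrightarrow> meval ?g m = Poly_Mapping.single (M m) 1"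
    "\<And>m. m \<in> Poly_Mapping.keys f \<Longrightarrow>
      p v0 ^ mdeg m * meval label_lift (M m) - D ^ mdeg (M m) * Poly_Mapping.single m 1 \<in> I"
    by metis
  define N where "N = N0 + (\<Sum>m\<in>Poly_Mapping.keys f. mdeg (M m))"
  have le: "mdeg (M m) \<le> N" if "m \<in> Poly_Mapping.keys f" for m
    using member_le_sum[OF that, of "\<lambda>m. mdeg (M m)"] by (simp add: N_def)
  have "homogenized_lift N (\<phi> f) = lin (\<lambda>m. D ^ (N - mdeg (M m)) * meval label_lift (M m)) f"
    unfolding homogenized_lift_def psubst_eq_lin lin_lin
    by (rule lin_cong) (simp add: M(1) lin_single)
  then have "p v0 ^ d * homogenized_lift N (\<phi> f) - D ^ N * f
      = lin (\<lambda>m. p v0 ^ d * (D ^ (N - mdeg (M m)) * meval label_lift (M m))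
        - D ^ N * Poly_Mapping.single m 1) f"
    by (simp add: mult_lin lin_monomials flip: lin_diff_fun) (simp add: lin_monomials flip: mult_lin)
  also have "\<dots> \<in> I"
  proof (rule ideal_lin[OF poly_ideal_I])
    fix m assume m: "m \<in> Poly_Mapping.keys f"
    have "D ^ N = D ^ (N - mdeg (M m)) * D ^ mdeg (M m)"
      using le[OF m] by (simp flip: power_add)
    moreover have "mdeg m = d"
      using d m by (simp add: homog_def)
    ultimately have "p v0 ^ d * (D ^ (N - mdeg (M m)) * meval label_lift (M m))
        - D ^ N * Poly_Mapping.single m 1
      = D ^ (N - mdeg (M m)) * (p v0 ^ mdeg m * meval label_lift (M m) - D ^ mdeg (M m) * Poly_Mapping.single m 1)"
      by (simp add: algebra_simps)
    then show "p v0 ^ d * (D ^ (N - mdeg (M m)) * meval label_lift (M m))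
        - D ^ N * Poly_Mapping.single m 1 \<in> I"
      using ideal_mult_left[OF poly_ideal_I M(2)[OF m] polys_power[OF D_in_polys]] by simp
  qed
  finally have "p v0 ^ d * homogenized_lift N (\<phi> f) - D ^ N * f \<in> I" .
  moreover have "p v0 ^ d * homogenized_lift N (\<phi> f) \<in> I"
    by (intro ideal_mult_left[OF poly_ideal_I] N0 polys_power p_in_polys) (simp add: N_def)
  ultimately show ?thesis
    using ideal_cong_mem[OF poly_ideal_I] by blast
qed

lemma hom_kernel_subset_saturation:
  "hom_kernel T \<theta> n ps \<subseteq> saturation (poly_ring {1..n}) I D"
  unfolding hom_kernel_eq
proof (rule Idl_minimal)
  show "poly_ideal {1..n} (saturation (poly_ring {1..n}) I D)"
    by (rule poly_ideal_saturation[OF poly_ideal_I D_in_polys])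
  show "{f \<in> polys {1..n}. \<phi> f \<in> J \<and> homogeneous f} \<subseteq> saturation (poly_ring {1..n}) I D"
    using homogeneous_kernel_in_saturation
    by (auto simp: saturation_poly_ring homogeneous_iff simp del: atLeastAtMost_iff)
qed

end

theorem corollary7:
  fixes T :: "('v, 'e) pre_digraph" and v0 :: 'v
    and \<theta> :: "'e \<Rightarrow> 'l" and stage :: "('v \<times> 'v) set"
    and n :: nat and ps :: "nat \<Rightarrow> 'e awalk"
  assumes "staged_tree T v0 \<theta> stage"
    and "bij_betw ps {1..n} (root_leaf_paths T v0)"
  shows "hom_kernel T \<theta> n ps =
    saturation (poly_ring {1..n}) (model_invariants T v0 \<theta> stage n ps)
      (denominator_product T v0 n ps)"
proof -
  interpret staged_tree T v0 \<theta> stage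
    by (rule assms(1))
  interpret indexed_staged_tree T v0 \<theta> stage n ps
    by unfold_locales (rule assms(2))
  show ?thesis
    using hom_kernel_subset_saturation saturation_subset_hom_kernel by (rule subset_antisym)
qed

end
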